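(* Let $T$ be a reflexive tree and let $\phi:E(T)\to\mathbb{Z}$ be an assignment of integers to the edges of $T$ that is positive on every loop. Suppose there exist two adjacent vertices $u,v\in V(T)$ with $\phi(u)=\phi(v)=1$. Then there exists $N$ such that for every prime $p\ge N$, the covering graph $T^{\sigma}$ (with $\sigma$ the voltage assignment into $\mathbb{Z}_p$ induced by $\phi$) is Hamiltonian.
   Context: A reflexive tree is a tree with exactly one loop added at every vertex; $\phi(w)$ denotes the integer assigned to the loop at $w$. For a prime $p$, the voltage assignment $\sigma$ into $\mathbb{Z}_p$ is defined by giving each edge $e$ a fixed orientation with arcs $e^+,e^-$ (for a loop, the primary and secondary arc) and setting $\sigma(e^+)=\phi(e)\bmod p$, $\sigma(e^-)=-\phi(e)\bmod p$. The lift $T^\sigma$ has vertex set $V(T)\times\mathbb{Z}_p$, with $(x,a)$ adjacent to $(y,b)$ iff some arc $(x,y)$ has $\sigma(x,y)=b-a$. *)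

theory Defs
  imports "Graph_Theory.Graph_Theory" "HOL-Computational_Algebra.Primes"
begin

text \<open>
  An undirected multigraph with a fixed orientation of its edges is a \<^typ>\<open>('v, 'e) pre_digraph\<close>
  \<open>G\<close>: the elements of \<open>arcs G\<close> are the edges, and \<open>tail G e\<close>, \<open>head G e\<close> are the ends of \<open>e\<close> in
  the order of the chosen orientation. Every edge \<open>e\<close>, loops included, gives rise to the two
  arcs \<open>Pos e\<close> (that is, \<open>e\<^sup>+\<close>, the primary arc of a loop) and \<open>Neg e\<close> (that is, \<open>e\<^sup>-\<close>).
\<close>

datatype 'e arc = Pos (edge: 'e) | Neg (edge: 'e)

fun arc_tail :: "('v, 'e) pre_digraph \<Rightarrow> 'e arc \<Rightarrow> 'v" where
  "arc_tail G (Pos e) = tail G e"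
| "arc_tail G (Neg e) = head G e"

fun arc_head :: "('v, 'e) pre_digraph \<Rightarrow> 'e arc \<Rightarrow> 'v" where
  "arc_head G (Pos e) = head G e"
| "arc_head G (Neg e) = tail G e"

definition bidirect :: "('v, 'e) pre_digraph \<Rightarrow> ('v, 'e arc) pre_digraph" where
  "bidirect G = \<lparr>verts = verts G, arcs = Pos ` arcs G \<union> Neg ` arcs G,
     tail = arc_tail G, head = arc_head G\<rparr>"

text \<open>
  The constants \<^const>\<open>forest\<close> and \<^const>\<open>tree\<close> of the library only exclude directed cycles, so they
  do not express acyclicity of the underlying undirected graph. A cycle of the undirected
  multigraph is a cycle of arcs, traversed in either direction, that uses no edge twice.
\<close>

definition undirected_cycle :: "('v, 'e) pre_digraph \<Rightarrow> 'e arc list \<Rightarrow> bool" where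
  "undirected_cycle G c \<longleftrightarrow> pre_digraph.cycle (bidirect G) c \<and> distinct (map edge c)"

definition undirected_tree :: "('v, 'e) pre_digraph \<Rightarrow> bool" where
  "undirected_tree G \<longleftrightarrow> fin_digraph G \<and> connected G \<and> (\<nexists>c. undirected_cycle G c)"

definition is_loop :: "('v, 'e) pre_digraph \<Rightarrow> 'e \<Rightarrow> bool" where
  "is_loop G e \<longleftrightarrow> e \<in> arcs G \<and> tail G e = head G e"

definition remove_loops :: "('v, 'e) pre_digraph \<Rightarrow> ('v, 'e) pre_digraph" where
  "remove_loops G = \<lparr>verts = verts G, arcs = {e \<in> arcs G. \<not> is_loop G e},
     tail = tail G, head = head G\<rparr>"

definition reflexive_tree :: "('v, 'e) pre_digraph \<Rightarrow> bool" where
  "reflexive_tree T \<longleftrightarrow> fin_digraph T \<and> undirected_tree (remove_loops T) \<and>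
     (\<forall>w \<in> verts T. \<exists>!e. is_loop T e \<and> tail T e = w)"

definition loop_at :: "('v, 'e) pre_digraph \<Rightarrow> 'v \<Rightarrow> 'e" where
  "loop_at T w = (THE e. is_loop T e \<and> tail T e = w)"

definition adjacent :: "('v, 'e) pre_digraph \<Rightarrow> 'v \<Rightarrow> 'v \<Rightarrow> bool" where
  "adjacent G u v \<longleftrightarrow> (\<exists>a \<in> arcs (bidirect G). arc_tail G a = u \<and> arc_head G a = v)"

text \<open>The group \<open>\<int>\<^sub>p\<close> is represented by the residues \<open>{0..<p}\<close> with arithmetic modulo \<open>p\<close>.\<close>

fun voltage :: "('e \<Rightarrow> int) \<Rightarrow> nat \<Rightarrow> 'e arc \<Rightarrow> int" where
  "voltage \<phi> p (Pos e) = \<phi> e mod int p"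
| "voltage \<phi> p (Neg e) = (- \<phi> e) mod int p"

definition lift :: "('v, 'e) pre_digraph \<Rightarrow> nat \<Rightarrow> ('e arc \<Rightarrow> int) \<Rightarrow> ('v \<times> int) pair_pre_digraph" where
  "lift T p \<sigma> = \<lparr>pverts = verts T \<times> {0..<int p},
     parcs = {((x, a), (y, b)) | x a y b. a \<in> {0..<int p} \<and> b \<in> {0..<int p} \<and>
       (\<exists>d \<in> arcs (bidirect T). arc_tail T d = x \<and> arc_head T d = y \<and> \<sigma> d = (b - a) mod int p)}\<rparr>"

lemma symmetric_lift_voltage: "symmetric (lift T p (voltage \<phi> p))"
proof -
  have neg: "(- k) mod int p = (a - b) mod int p" if "k mod int p = (b - a) mod int p" for k a b
    using that by (metis minus_diff_eq mod_minus_cong)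
  have flip: "\<exists>d' \<in> arcs (bidirect T). arc_tail T d' = y \<and> arc_head T d' = x \<and>
      voltage \<phi> p d' = (a - b) mod int p"
    if "d \<in> arcs (bidirect T)" "arc_tail T d = x" "arc_head T d = y"
      "voltage \<phi> p d = (b - a) mod int p" for d x y a b
  proof (cases d)
    case (Pos e)
    then show ?thesis using that neg[of "\<phi> e" b a]
      by (intro bexI[of _ "Neg e"]) (auto simp: bidirect_def)
  next
    case (Neg e)
    then show ?thesis using that neg[of "- \<phi> e" b a]
      by (intro bexI[of _ "Pos e"]) (auto simp: bidirect_def)
  qed
  show ?thesis
    unfolding symmetric_def sym_def
    using flip by (auto simp: lift_def)
qed

text \<open>
  For a symmetric \<open>G\<close>: a cycle of the undirected simple graph has at least three vertices,
  which rules out the closed walks that use one edge back and forth.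
\<close>

definition hamiltonian :: "'a pair_pre_digraph \<Rightarrow> bool" where
  "hamiltonian G \<longleftrightarrow>
     (\<exists>c. pre_digraph.cycle (with_proj G) c \<and> 3 \<le> length c \<and> fst ` set c = pverts G)"

end

theory Submission
  imports Defs "HOL-Library.Multiset"
begin

text \<open>
  Over a vertex \<open>w\<close> the lift contains a cycle of length \<open>p\<close>, the rail of \<open>w\<close>; only these cycles and
  one edge class between neighbouring vertices of a spanning tree are used. A set of fibres hanging
  on a vertex \<open>r\<close> is contracted to a chord: a Hamiltonian path of these fibres whose ends are
  adjacent to \<open>(r, c)\<close> and \<open>(r, c + d)\<close>. By translation it is available for every \<open>c\<close>, and the length
  \<open>d\<close> stays bounded independently of \<open>p\<close>. Removing the vertices other than \<open>u\<close> and \<open>v\<close> from the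
  leaves inwards, the rail of \<open>w\<close> together with all chords at \<open>w\<close> is turned into a single chord at the
  neighbour of \<open>w\<close>. In units of the step \<open>k\<close> of the rail, a chord of bounded length has length
  \<open>\<mu> \<le> p / 2\<close> which is either bounded or at least about \<open>p / k\<close>, and two long ones are almost
  equal or far apart. Almost equal long chords are absorbed in pairs: a short piece at the end of the
  path is moved into a distant edge. The remaining long chords, of very different lengths, are
  absorbed by path rotations, longest first, and the bounded ones by rotations near the end.

  What is left is a prism over the \<open>p\<close>-cycle with bounded chords along its two rails. If the number
  of chords of even length is odd, one strand winds once around the prism; if it is even, two strands
  run in parallel, which absorb odd chords one at a time and even chords on the same rail in pairs,
  and a last even chord on each rail is used to close the ragged ends.
\<close>

section \<open>Hamiltonian paths and chords\<close>

definition ham_path :: "('a \<Rightarrow> 'a \<Rightarrow> bool) \<Rightarrow> 'a set \<Rightarrow> 'a \<Rightarrow> 'a \<Rightarrow> bool" where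
  "ham_path E S a b \<longleftrightarrow>
     (\<exists>l. l \<noteq> [] \<and> distinct l \<and> set l = S \<and> successively E l \<and> hd l = a \<and> last l = b)"

text \<open>Seen from outside, \<open>S\<close> acts as one edge between \<open>x\<close> and
  \<open>y\<close>: the constructions below enter it next to one of them, visit all of it and leave
  next to the other.\<close>

definition chord :: "('a \<Rightarrow> 'a \<Rightarrow> bool) \<Rightarrow> 'a set \<Rightarrow> 'a \<Rightarrow> 'a \<Rightarrow> bool" where
  "chord E S x y \<longleftrightarrow> (\<exists>a b. ham_path E S a b \<and> E x a \<and> E b y)"

lemma ham_path_single: "ham_path E {a} a a"
  unfolding ham_path_def by (rule exI[of _ "[a]"]) auto

lemma ham_path_ends: "ham_path E S a b \<Longrightarrow> a \<in> S \<and> b \<in> S"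
  unfolding ham_path_def by auto

text \<open>Serves to show that the two ends of a contracted fibre differ, so that the chord it
  becomes has nonzero length.\<close>

lemma ham_path_same_ends: "ham_path E S a a \<Longrightarrow> S = {a}"
proof -
  assume "ham_path E S a a"
  then obtain l where l: "l \<noteq> []" "distinct l" "set l = S" "hd l = a" "last l = a"
    unfolding ham_path_def by blast
  then show ?thesis by (cases l) (auto split: if_splits)
qed

lemma ham_path_join:
  assumes "ham_path E S a b" "ham_path E S' c d" "E b c" "S \<inter> S' = {}"
  shows "ham_path E (S \<union> S') a d"
proof -
  obtain l where l: "l \<noteq> []" "distinct l" "set l = S" "successively E l" "hd l = a" "last l = b"
    using assms(1) unfolding ham_path_def by blast
  obtain l' where l': "l' \<noteq> []" "distinct l'" "set l' = S'" "successively E l'"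
      "hd l' = c" "last l' = d"
    using assms(2) unfolding ham_path_def by blast
  show ?thesis
    unfolding ham_path_def using l l' assms(3,4)
    by (intro exI[of _ "l @ l'"]) (auto simp: successively_append_iff)
qed

lemma ham_path_rev:
  assumes "\<And>x y. E x y \<Longrightarrow> E y x" "ham_path E S a b"
  shows "ham_path E S b a"
proof -
  obtain l where l: "l \<noteq> []" "distinct l" "set l = S" "successively E l" "hd l = a" "last l = b"
    using assms(2) unfolding ham_path_def by blast
  have "successively (\<lambda>x y. E y x) l"
    using l(4) by (rule successively_mono) (use assms(1) in auto)
  then show ?thesis
    unfolding ham_path_def using l
    by (intro exI[of _ "rev l"]) (auto simp: hd_rev last_rev)
qed

lemma ham_path_map:
  assumes "ham_path E S a b" "inj_on f S" "\<And>x y. x \<in> S \<Longrightarrow> y \<in> S \<Longrightarrow> E x y \<Longrightarrow> E (f x) (f y)"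
  shows "ham_path E (f ` S) (f a) (f b)"
proof -
  obtain l where l: "l \<noteq> []" "distinct l" "set l = S" "successively E l" "hd l = a" "last l = b"
    using assms(1) unfolding ham_path_def by blast
  have "successively (\<lambda>x y. E (f x) (f y)) l"
    using l(4) by (rule successively_mono) (use l(3) assms(3) in auto)
  then show ?thesis
    unfolding ham_path_def using l assms(2)
    by (intro exI[of _ "map f l"]) (auto simp: hd_map last_map distinct_map successively_map)
qed

lemma chord_sym:
  assumes "\<And>x y. E x y \<Longrightarrow> E y x" "chord E S x y"
  shows "chord E S y x"
proof -
  obtain a b where "ham_path E S a b" "E x a" "E b y"
    using assms(2) unfolding chord_def by blast
  then have "ham_path E S b a" "E y b" "E a x"
    using ham_path_rev[of E S a b] assms(1) by auto
  then show ?thesis unfolding chord_def by blast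
qed

lemma ham_path_chord_join:
  assumes "ham_path E S a b" "ham_path E S' c d" "chord E U b c"
    "S \<inter> S' = {}" "S \<inter> U = {}" "S' \<inter> U = {}"
  shows "ham_path E (S \<union> S' \<union> U) a d"
proof -
  obtain x y where xy: "ham_path E U x y" "E b x" "E y c"
    using assms(3) unfolding chord_def by blast
  have "ham_path E (S \<union> U) a y"
    using ham_path_join[OF assms(1) xy(1,2) assms(5)] .
  then have "ham_path E (S \<union> U \<union> S') a d"
    by (rule ham_path_join[OF _ assms(2) xy(3)]) (use assms in auto)
  then show ?thesis by (simp add: Un_ac)
qed

lemma Int_Un_empty:
  "A \<inter> A' = {} \<Longrightarrow> A \<inter> U' = {} \<Longrightarrow> A' \<inter> U = {} \<Longrightarrow> U \<inter> U' = {} \<Longrightarrow> (A \<union> U) \<inter> (A' \<union> U') = {}"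
  by blast

section \<open>Routes through coordinates and chords\<close>

locale chorded =
  fixes E :: "'a \<Rightarrow> 'a \<Rightarrow> bool" and q :: "'n \<Rightarrow> 'a" and J :: "'n set"
    and S :: "'i \<Rightarrow> 'a set" and Ids :: "'i set"
  assumes sym: "E x y \<Longrightarrow> E y x"
    and inj: "inj_on q J"
    and disjoint_nodes: "i \<in> Ids \<Longrightarrow> S i \<inter> q ` J = {}"
    and disjoint_chords: "i \<in> Ids \<Longrightarrow> j \<in> Ids \<Longrightarrow> i \<noteq> j \<Longrightarrow> S i \<inter> S j = {}"
begin

text \<open>A partial Hamiltonian path with its bookkeeping: \<open>I\<close> is the set of
  coordinates visited and \<open>X\<close> the set of chords consumed. Coordinates are confined to
  \<open>J\<close> because \<open>q\<close> is assumed injective only there; elsewhere it may repeat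
  vertices, which is how cyclic rails get integer coordinates.\<close>

definition route :: "'n set \<Rightarrow> 'i set \<Rightarrow> 'n \<Rightarrow> 'n \<Rightarrow> bool" where
  "route I X a b \<longleftrightarrow> I \<subseteq> J \<and> X \<subseteq> Ids \<and> a \<in> I \<and> b \<in> I \<and>
     ham_path E (q ` I \<union> \<Union>(S ` X)) (q a) (q b)"

abbreviation link :: "'i \<Rightarrow> 'n \<Rightarrow> 'n \<Rightarrow> bool" where
  "link i x y \<equiv> chord E (S i) (q x) (q y)"

lemma link_sym: "link i x y \<Longrightarrow> link i y x"
  using chord_sym[of E, OF sym] by blast

lemma route_single: "a \<in> J \<Longrightarrow> route {a} {} a a"
  unfolding route_def by (auto intro: ham_path_single)

lemma route_sym: "route I X a b \<Longrightarrow> route I X b a"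
  unfolding route_def using ham_path_rev[of E, OF sym] by blast

lemma node_sets_disjoint: "I \<subseteq> J \<Longrightarrow> I' \<subseteq> J \<Longrightarrow> I \<inter> I' = {} \<Longrightarrow> q ` I \<inter> q ` I' = {}"
  using inj inj_on_image_Int[of q J I I'] by simp

lemma node_chord_disjoint: "I \<subseteq> J \<Longrightarrow> X \<subseteq> Ids \<Longrightarrow> q ` I \<inter> \<Union>(S ` X) = {}"
  using disjoint_nodes by blast

lemma chord_sets_disjoint:
  "X \<subseteq> Ids \<Longrightarrow> X' \<subseteq> Ids \<Longrightarrow> X \<inter> X' = {} \<Longrightarrow> \<Union>(S ` X) \<inter> \<Union>(S ` X') = {}"
  using disjoint_chords by blast

text \<open>Disjointness of coordinates and of chord names carries over to the vertex sets, since
  \<open>q\<close> is injective on \<open>J\<close> and the chord interiors avoid each other and the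
  nodes. The results \<open>K\<close> and \<open>Y\<close> are variables tied by equations, so that
  the rule can produce sets written in any form and leaves a set equality to be proved.\<close>

lemma route_join:
  assumes "route I X a b" "route I' X' c d" "E (q b) (q c)"
    and "I \<inter> I' = {}" "X \<inter> X' = {}" "K = I \<union> I'" "Y = X \<union> X'"
  shows "route K Y a d"
proof -
  have sub: "I \<subseteq> J" "I' \<subseteq> J" "X \<subseteq> Ids" "X' \<subseteq> Ids"
    using assms(1,2) unfolding route_def by auto
  have dis: "(q ` I \<union> \<Union>(S ` X)) \<inter> (q ` I' \<union> \<Union>(S ` X')) = {}"
    by (rule Int_Un_empty[OF node_sets_disjoint[OF sub(1,2) assms(4)] node_chord_disjoint[OF sub(1,4)]
      node_chord_disjoint[OF sub(2,3)] chord_sets_disjoint[OF sub(3,4) assms(5)]])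
  have "ham_path E ((q ` I \<union> \<Union>(S ` X)) \<union> (q ` I' \<union> \<Union>(S ` X'))) (q a) (q d)"
    by (rule ham_path_join[of E, OF _ _ assms(3) dis]) (use assms(1,2) in \<open>simp_all add: route_def\<close>)
  moreover have "(q ` I \<union> \<Union>(S ` X)) \<union> (q ` I' \<union> \<Union>(S ` X')) = q ` K \<union> \<Union>(S ` Y)"
    unfolding assms(6,7) by blast
  ultimately show ?thesis
    using assms unfolding route_def by auto
qed

lemma route_link:
  assumes "route I X a b" "route I' X' c d" "link i b c" "i \<in> Ids"
    and "I \<inter> I' = {}" "X \<inter> X' = {}" "i \<notin> X" "i \<notin> X'"
    and "K = I \<union> I'" "Y = insert i (X \<union> X')"
  shows "route K Y a d"
proof -
  have sub: "I \<subseteq> J" "I' \<subseteq> J" "X \<subseteq> Ids" "X' \<subseteq> Ids" "{i} \<subseteq> Ids"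
    using assms(1,2,4) unfolding route_def by auto
  have dis: "(q ` I \<union> \<Union>(S ` X)) \<inter> (q ` I' \<union> \<Union>(S ` X')) = {}"
    by (rule Int_Un_empty[OF node_sets_disjoint[OF sub(1,2) assms(5)] node_chord_disjoint[OF sub(1,4)]
      node_chord_disjoint[OF sub(2,3)] chord_sets_disjoint[OF sub(3,4) assms(6)]])
  have dis1: "(q ` I \<union> \<Union>(S ` X)) \<inter> S i = {}"
    using Int_Un_empty[of _ "{}", OF _ node_chord_disjoint[OF sub(1,5)] _ chord_sets_disjoint[OF sub(3,5)]] assms(7)
    by simp
  have dis2: "(q ` I' \<union> \<Union>(S ` X')) \<inter> S i = {}"
    using Int_Un_empty[of _ "{}", OF _ node_chord_disjoint[OF sub(2,5)] _ chord_sets_disjoint[OF sub(4,5)]] assms(8)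
    by simp
  have "ham_path E ((q ` I \<union> \<Union>(S ` X)) \<union> (q ` I' \<union> \<Union>(S ` X')) \<union> S i) (q a) (q d)"
    by (rule ham_path_chord_join[OF _ _ assms(3) dis dis1 dis2])
      (use assms(1,2) in \<open>simp_all add: route_def\<close>)
  moreover have "(q ` I \<union> \<Union>(S ` X)) \<union> (q ` I' \<union> \<Union>(S ` X')) \<union> S i = q ` K \<union> \<Union>(S ` Y)"
    unfolding assms(9,10) by blast
  ultimately show ?thesis
    using assms unfolding route_def by auto
qed

lemma route_snoc:
  assumes "route I X a b" "E (q b) (q c)" "c \<in> J" "c \<notin> I" "K = insert c I"
  shows "route K X a c"
  using route_join[OF assms(1) route_single[OF assms(3)] assms(2)] assms(4,5) by auto

lemma route_snoc_link:
  assumes "route I X a b" "link i b c" "i \<in> Ids" "i \<notin> X" "c \<in> J" "c \<notin> I"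
    and "K = insert c I" "Y = insert i X"
  shows "route K Y a c"
  by (rule route_link[OF assms(1) route_single[OF assms(5)] assms(2,3)]) (use assms in auto)

end

section \<open>The prism with chords\<close>

text \<open>A coordinate \<open>(b, x)\<close> is the vertex of column \<open>x\<close> on rail
  \<open>b\<close>. The adjacencies are required for all integers \<open>x\<close>, so a prism over
  a cycle is described by a periodic \<open>q\<close>. The ends of chord \<open>i\<close> lie on the
  rail \<open>host i\<close>, at a distance of \<open>d i\<close> columns.\<close>

locale ladder = chorded E q J S Ids
  for E :: "'a \<Rightarrow> 'a \<Rightarrow> bool" and q :: "bool \<times> int \<Rightarrow> 'a" and J
    and S :: "'i \<Rightarrow> 'a set" and Ids +
  fixes host :: "'i \<Rightarrow> bool" and d :: "'i \<Rightarrow> int"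
  assumes rail: "E (q (b, x)) (q (b, x + 1))"
    and rung: "E (q (b, x)) (q (\<not> b, x))"
    and length_pos: "i \<in> Ids \<Longrightarrow> 0 < d i"
    and link_host: "i \<in> Ids \<Longrightarrow> link i (host i, x) (host i, x + d i)"
begin

lemma rail_eq: "y = x + 1 \<Longrightarrow> E (q (b, x)) (q (b, y))"
  using rail by simp

lemma rung_eq: "b' \<noteq> b \<Longrightarrow> E (q (b, x)) (q (b', x))"
  using rung[of b x] by (cases b; cases b') auto

lemma link_host_eq: "i \<in> Ids \<Longrightarrow> g = host i \<Longrightarrow> y = x + d i \<Longrightarrow> link i (g, x) (g, y)"
  using link_host by simp

lemma link_host_down: "i \<in> Ids \<Longrightarrow> g = host i \<Longrightarrow> y = x - d i \<Longrightarrow> link i (g, x) (g, y)"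
  using link_sym[OF link_host[of i y]] by simp

lemma line_up:
  assumes "c \<le> c'" "{b} \<times> {c..c'} \<subseteq> J"
  shows "route ({b} \<times> {c..c'}) {} (b, c) (b, c')"
  using assms
proof (induction c' rule: int_ge_induct)
  case base
  then show ?case using route_single[of "(b, c)"] by simp
next
  case (step i)
  have "{b} \<times> {c..i} \<subseteq> J" using step.prems by auto
  then have "route ({b} \<times> {c..i}) {} (b, c) (b, i)" using step.IH by simp
  then show ?case
    by (rule route_snoc[OF _ rail]) (use step in auto)
qed

lemma line_down:
  "c \<le> c' \<Longrightarrow> {b} \<times> {c..c'} \<subseteq> J \<Longrightarrow> route ({b} \<times> {c..c'}) {} (b, c') (b, c)"
  using route_sym[OF line_up] .

text \<open>Two columns are visited in the order \<open>(h, x)\<close>,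
  \<open>(\<not> h, x)\<close>, \<open>(\<not> h, x + 1)\<close>, \<open>(h, x + 1)\<close>, which
  brings the end back to rail \<open>h\<close>; hence the even number of columns.\<close>

lemma extend_zigzag:
  assumes "route I X z (h, a)" "UNIV \<times> {a + 1..a + 2 * int n} \<subseteq> J"
    "I \<inter> UNIV \<times> {a + 1..a + 2 * int n} = {}"
  shows "route (I \<union> UNIV \<times> {a + 1..a + 2 * int n}) X z (h, a + 2 * int n)"
  using assms(2,3)
proof (induction n)
  case 0
  then show ?case using assms(1) by simp
next
  case (Suc n)
  let ?b = "a + 2 * int n"
  let ?I = "I \<union> UNIV \<times> {a + 1..?b}"
  have J: "(x, y) \<in> J" "(x, y) \<notin> I" if "a < y" "y \<le> ?b + 2" for x y
    using that Suc.prems by auto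
  have "UNIV \<times> {a + 1..?b} \<subseteq> J" "I \<inter> UNIV \<times> {a + 1..?b} = {}"
    using J by auto
  then have "route ?I X z (h, ?b)" using Suc.IH by simp
  then have "route (insert (h, ?b + 1) ?I) X z (h, ?b + 1)"
    by (rule route_snoc[OF _ rail]) (use J in auto)
  then have "route (insert (\<not> h, ?b + 1) (insert (h, ?b + 1) ?I)) X z (\<not> h, ?b + 1)"
    by (rule route_snoc[OF _ rung]) (use J in auto)
  then have "route (insert (\<not> h, ?b + 2) (insert (\<not> h, ?b + 1) (insert (h, ?b + 1) ?I))) X
      z (\<not> h, ?b + 2)"
    by (rule route_snoc[OF _ rail_eq]) (use J in auto)
  then have "route (insert (h, ?b + 2) (insert (\<not> h, ?b + 2) (insert (\<not> h, ?b + 1)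
      (insert (h, ?b + 1) ?I)))) X z (h, ?b + 2)"
    by (rule route_snoc[OF _ rung_eq]) (use J in auto)
  moreover have "insert (h, ?b + 2) (insert (\<not> h, ?b + 2) (insert (\<not> h, ?b + 1)
      (insert (h, ?b + 1) ?I))) = I \<union> UNIV \<times> {a + 1..?b + 2}"
    by auto
  ultimately show ?case by (simp add: algebra_simps)
qed

section \<open>One strand filling whole columns\<close>

lemma strand_column:
  assumes "route (UNIV \<times> {0..c}) X a (h, c)" "UNIV \<times> {0..c + 1} \<subseteq> J" "0 \<le> c"
  shows "route (UNIV \<times> {0..c + 1}) X a (\<not> h, c + 1)"
proof -
  have "route (insert (h, c + 1) (UNIV \<times> {0..c})) X a (h, c + 1)"
    by (rule route_snoc[OF assms(1) rail]) (use assms in auto)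
  then show ?thesis
    by (rule route_snoc[OF _ rung]) (use assms in auto)
qed

text \<open>The strand passes through \<open>(h, c + 1)\<close> to \<open>(\<not> h, c + 1)\<close>,
  jumps along the chord, returns on rail \<open>\<not> h\<close> to column \<open>c + 2\<close>,
  changes to rail \<open>h\<close> and runs up again. The end stays on rail \<open>h\<close>
  although \<open>1 + d i\<close> columns have been added.\<close>

lemma strand_chord:
  assumes "route (UNIV \<times> {0..c}) X a (h, c)" "UNIV \<times> {0..c + 1 + d i} \<subseteq> J" "0 \<le> c"
    "i \<in> Ids" "i \<notin> X" "host i \<noteq> h"
  shows "route (UNIV \<times> {0..c + 1 + d i}) (insert i X) a (h, c + 1 + d i)"
proof -
  let ?g = "\<not> h"
  have g: "?g = host i" using assms(6) by auto
  have d: "0 < d i" using length_pos assms(4) by blast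
  have J: "(x, y) \<in> J" if "0 \<le> y" "y \<le> c + 1 + d i" for x y
    using assms(2) that by auto
  let ?I1 = "insert (h, c + 1) (UNIV \<times> {0..c})"
  have "route ?I1 X a (h, c + 1)"
    by (rule route_snoc[OF assms(1) rail]) (use assms d J in auto)
  then have 1: "route (insert (?g, c + 1) ?I1) X a (?g, c + 1)"
    by (rule route_snoc[OF _ rung]) (use assms d J in auto)
  have 2: "route ({?g} \<times> {c + 2..c + 1 + d i}) {} (?g, c + 1 + d i) (?g, c + 2)"
    by (rule line_down) (use d J assms in auto)
  have 3: "route (insert (?g, c + 1) ?I1 \<union> {?g} \<times> {c + 2..c + 1 + d i}) (insert i X) a (?g, c + 2)"
    by (rule route_link[OF 1 2 link_host_eq[OF assms(4) g]]) (use assms in auto)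
  have 4: "route ({h} \<times> {c + 2..c + 1 + d i}) {} (h, c + 2) (h, c + 1 + d i)"
    by (rule line_up) (use d J assms in auto)
  show ?thesis
    by (rule route_join[OF 3 4 rung_eq]) (use assms d in auto)
qed

lemma strand_columns:
  assumes "route (UNIV \<times> {0..c}) X a (h, c)" "0 \<le> c" "UNIV \<times> {0..c + int n} \<subseteq> J"
  shows "\<exists>h'. route (UNIV \<times> {0..c + int n}) X a (h', c + int n) \<and>
    (even (int n) \<longleftrightarrow> h' = h)"
  using assms(3)
proof (induction n)
  case 0
  then show ?case using assms by auto
next
  case (Suc n)
  have "UNIV \<times> {0..c + int n} \<subseteq> J" using Suc.prems by auto
  then obtain h' where h': "route (UNIV \<times> {0..c + int n}) X a (h', c + int n)"
      "even (int n) \<longleftrightarrow> h' = h"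
    using Suc.IH by blast
  show ?case
    using strand_column[OF h'(1)] h'(2) assms(2) Suc.prems by (auto simp: algebra_simps)
qed

text \<open>Every plain column switches the rail of the end. A chord adds \<open>1 + d i\<close>
  columns without switching it: for odd \<open>d i\<close> this agrees with the effect of as many
  plain columns, for even \<open>d i\<close> it is off by one, whence the count of even chords in
  the parity. The length \<open>d i + 2\<close> allows for one plain column before each chord, which
  moves the end off the rail of the chord if necessary.\<close>

lemma strand_chords:
  assumes "route (UNIV \<times> {0..c}) X a (h, c)" "0 \<le> c" "distinct xs" "set xs \<subseteq> Ids"
    "set xs \<inter> X = {}" "UNIV \<times> {0..c + (\<Sum>i\<leftarrow>xs. d i + 2)} \<subseteq> J"
  shows "\<exists>c' h'. c \<le> c' \<and> c' \<le> c + (\<Sum>i\<leftarrow>xs. d i + 2) \<and>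
    route (UNIV \<times> {0..c'}) (X \<union> set xs) a (h', c') \<and>
    (even (c' - c + int (length (filter (\<lambda>i. even (d i)) xs))) \<longleftrightarrow> h' = h)"
  using assms
proof (induction xs arbitrary: c X h)
  case Nil
  then show ?case by auto
next
  case (Cons i xs)
  have d: "0 < d i" using length_pos Cons.prems by auto
  have nonneg: "0 \<le> (\<Sum>i\<leftarrow>xs. d i + 2)"
    by (rule sum_list_nonneg) (use length_pos Cons.prems(4) in force)
  have J: "UNIV \<times> {0..x} \<subseteq> J" if "x \<le> c + (\<Sum>i\<leftarrow>i # xs. d i + 2)" for x
    by (rule order_trans[OF _ Cons.prems(6)]) (use that in auto)
  obtain c1 h1 where c1: "c \<le> c1" "c1 \<le> c + 1" "route (UNIV \<times> {0..c1}) X a (h1, c1)"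
      "even (c1 - c) \<longleftrightarrow> h1 = h" "host i \<noteq> h1"
  proof (cases "host i = h")
    case True
    have "route (UNIV \<times> {0..c + 1}) X a (\<not> h, c + 1)"
      by (rule strand_column[OF Cons.prems(1)]) (use J[of "c + 1"] d nonneg Cons.prems(2) in auto)
    with True show ?thesis by (intro that[of "c + 1" "\<not> h"]) auto
  next
    case False
    then show ?thesis using that[of c h] Cons.prems(1) by simp
  qed
  have 2: "route (UNIV \<times> {0..c1 + 1 + d i}) (insert i X) a (h1, c1 + 1 + d i)"
    by (rule strand_chord[OF c1(3)]) (use c1 J[of "c1 + 1 + d i"] nonneg Cons.prems in auto)
  have "\<exists>c' h'. c1 + 1 + d i \<le> c' \<and> c' \<le> c1 + 1 + d i + (\<Sum>i\<leftarrow>xs. d i + 2) \<and>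
    route (UNIV \<times> {0..c'}) (insert i X \<union> set xs) a (h', c') \<and>
    (even (c' - (c1 + 1 + d i) + int (length (filter (\<lambda>i. even (d i)) xs))) \<longleftrightarrow> h' = h1)"
    by (rule Cons.IH[OF 2])
      (use c1 d Cons.prems J[of "c1 + 1 + d i + (\<Sum>i\<leftarrow>xs. d i + 2)"] in auto)
  then obtain c' h' where c': "c1 + 1 + d i \<le> c'" "c' \<le> c1 + 1 + d i + (\<Sum>i\<leftarrow>xs. d i + 2)"
    "route (UNIV \<times> {0..c'}) (insert i X \<union> set xs) a (h', c')"
    "even (c' - (c1 + 1 + d i) + int (length (filter (\<lambda>i. even (d i)) xs))) \<longleftrightarrow> h' = h1"
    by blast
  show ?case
  proof (intro exI[of _ c'] exI[of _ h'] conjI)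
    show "route (UNIV \<times> {0..c'}) (X \<union> set (i # xs)) a (h', c')"
      using c'(3) by simp
    show "even (c' - c + int (length (filter (\<lambda>i. even (d i)) (i # xs)))) \<longleftrightarrow> h' = h"
      using c'(4) c1(4) by (cases "even (d i)"; cases h'; cases h1; cases h) auto
  qed (use c' c1 d in auto)
qed

section \<open>Two parallel strands\<close>

text \<open>Two parallel strands joined at their left ends form one path, whose two ends are the vertices of
  the last column \<open>c\<close>; \<open>Z\<close> is the part of column 0 that is used.\<close>

definition front :: "(bool \<times> int) set \<Rightarrow> 'i set \<Rightarrow> int \<Rightarrow> bool" where
  "front Z X c \<longleftrightarrow> route (Z \<union> UNIV \<times> {1..c}) X (True, c) (False, c)"

lemma front_side: "front Z X c \<Longrightarrow> h \<noteq> g \<Longrightarrow> route (Z \<union> UNIV \<times> {1..c}) X (h, c) (g, c)"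
  unfolding front_def using route_sym by (cases h; cases g) auto

lemma frontI: "route (Z \<union> UNIV \<times> {1..c}) X (h, c) (g, c) \<Longrightarrow> h \<noteq> g \<Longrightarrow> front Z X c"
  unfolding front_def using route_sym by (cases h; cases g) auto

lemma front_column:
  assumes "front Z X c" "Z \<subseteq> UNIV \<times> {0}" "0 \<le> c" "UNIV \<times> {1..c + 1} \<subseteq> J"
  shows "front Z X (c + 1)"
proof -
  let ?I = "Z \<union> UNIV \<times> {1..c}"
  have "route (insert (False, c + 1) ?I) X (True, c) (False, c + 1)"
    by (rule route_snoc[OF _ rail]) (use assms in \<open>auto simp: front_def\<close>)
  then have "route (insert (True, c + 1) (insert (False, c + 1) ?I)) X (False, c + 1) (True, c + 1)"
    by (rule route_snoc[OF route_sym rail]) (use assms in auto)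
  moreover have "insert (True, c + 1) (insert (False, c + 1) ?I) = Z \<union> UNIV \<times> {1..c + 1}"
    using assms(3) by (auto intro: UNIV_bool)
  ultimately show ?thesis by - (rule frontI[of Z _ _ False True], simp_all)
qed

lemma front_columns:
  assumes "front Z X c" "Z \<subseteq> UNIV \<times> {0}" "0 \<le> c" "c \<le> c'" "UNIV \<times> {1..c'} \<subseteq> J"
  shows "front Z X c'"
  using assms(4,5)
proof (induction c' rule: int_ge_induct)
  case base
  then show ?case using assms(1) by simp
next
  case (step i)
  have "UNIV \<times> {1..i} \<subseteq> J" using step.prems by auto
  then show ?case using front_column[of Z X i] step assms by auto
qed

text \<open>One strand steps to column \<open>c + 1\<close> on the rail of the chord and jumps to
  column \<open>c + 1 + d i\<close>. The other steps forward on its own rail and fills both rails of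
  the \<open>d i - 1\<close> columns in between by a zigzag, which returns to its rail because this
  number is even.\<close>

lemma front_odd_chord:
  assumes "front Z X c" "Z \<subseteq> UNIV \<times> {0}" "0 \<le> c" "UNIV \<times> {1..c + 1 + d i} \<subseteq> J"
    "i \<in> Ids" "i \<notin> X" "odd (d i)"
  shows "front Z (insert i X) (c + 1 + d i)"
proof -
  define g where "g = host i"
  let ?h = "\<not> g"
  obtain n where n: "d i = 2 * int n + 1"
  proof -
    obtain k where "d i = 2 * k + 1" using assms(7) by (rule oddE)
    with length_pos[OF assms(5)] show ?thesis by (intro that[of "nat k"]) auto
  qed
  let ?I = "Z \<union> UNIV \<times> {1..c}"
  have J: "(x, y) \<in> J" if "1 \<le> y" "y \<le> c + 1 + d i" for x y
    using assms(4) that by auto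
  have new: "(x, y) \<notin> Z" if "1 \<le> y" for x y
    using assms(2) that by auto
  have "route ?I X (?h, c) (g, c)"
    by (rule front_side[OF assms(1)]) simp
  then have "route (insert (g, c + 1) ?I) X (?h, c) (g, c + 1)"
    by (rule route_snoc[OF _ rail]) (use assms(3) n in \<open>auto simp: new intro!: J\<close>)
  then have "route (insert (g, c + 1 + d i) (insert (g, c + 1) ?I)) (insert i X) (?h, c) (g, c + 1 + d i)"
    by (rule route_snoc_link[OF _ link_host_eq])
      (use assms n g_def in \<open>auto simp: new intro!: J\<close>)
  then have "route (insert (?h, c + 1) (insert (g, c + 1 + d i) (insert (g, c + 1) ?I))) (insert i X)
      (g, c + 1 + d i) (?h, c + 1)"
    by (rule route_snoc[OF route_sym rail]) (use assms n in \<open>auto simp: new intro!: J\<close>)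
  then have "route (insert (?h, c + 1) (insert (g, c + 1 + d i) (insert (g, c + 1) ?I))
      \<union> UNIV \<times> {c + 1 + 1..c + 1 + 2 * int n}) (insert i X)
      (g, c + 1 + d i) (?h, c + 1 + 2 * int n)"
    by (rule extend_zigzag) (use assms n in \<open>auto simp: new intro!: J\<close>)
  then have "route (insert (?h, c + 1 + d i) (insert (?h, c + 1) (insert (g, c + 1 + d i) (insert (g, c + 1) ?I))
      \<union> UNIV \<times> {c + 1 + 1..c + 1 + 2 * int n})) (insert i X)
      (g, c + 1 + d i) (?h, c + 1 + d i)"
    by (rule route_snoc[OF _ rail_eq]) (use assms n in \<open>auto simp: new intro!: J\<close>)
  moreover have "insert (?h, c + 1 + d i) (insert (?h, c + 1) (insert (g, c + 1 + d i) (insert (g, c + 1) ?I))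
      \<union> UNIV \<times> {c + 1 + 1..c + 1 + 2 * int n}) = Z \<union> UNIV \<times> {1..c + 1 + d i}"
    using n assms(3) by auto
  ultimately show ?thesis by - (rule frontI[of Z _ _ g ?h], simp_all)
qed

text \<open>For a single even chord the zigzag would end on the wrong rail, so two chords are made
  to overlap. The strand on rail \<open>g\<close> takes chord \<open>i\<close>, returns to column
  \<open>c + 3\<close>, changes to rail \<open>\<not> g\<close>, runs up again, zigzags over
  \<open>d j - d i\<close> further columns and steps to column \<open>c + 2 + d j\<close>. The other
  strand crosses to rail \<open>g\<close> in column \<open>c + 2\<close> and takes chord
  \<open>j\<close>, so that the strands exchange rails.\<close>

lemma front_even_pair:
  assumes "front Z X c" "Z \<subseteq> UNIV \<times> {0}" "0 \<le> c" "UNIV \<times> {1..c + 2 + d j} \<subseteq> J"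
    "i \<in> Ids" "j \<in> Ids" "i \<notin> X" "j \<notin> X" "i \<noteq> j" "even (d i)" "even (d j)" "d i \<le> d j"
    "host i = host j"
  shows "front Z (insert i (insert j X)) (c + 2 + d j)"
proof -
  define g where "g = host i"
  let ?h = "\<not> g"
  have d2: "2 \<le> d i" using length_pos[OF assms(5)] assms(10) by presburger
  obtain n where n: "d j = d i + 2 * int n"
  proof -
    have "even (d j - d i)" using assms(10,11) by simp
    then obtain k where "d j - d i = 2 * k" by (rule evenE)
    with assms(12) show ?thesis by (intro that[of "nat k"]) auto
  qed
  let ?I = "Z \<union> UNIV \<times> {1..c}"
  have J: "(x, y) \<in> J" if "1 \<le> y" "y \<le> c + 2 + d j" for x y
    using assms(4) that by auto
  have new: "(x, y) \<notin> Z" if "1 \<le> y" for x y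
    using assms(2) that by auto
  have "route ?I X (?h, c) (g, c)"
    by (rule front_side[OF assms(1)]) simp
  then have 1: "route (insert (g, c + 1) ?I) X (?h, c) (g, c + 1)"
    by (rule route_snoc[OF _ rail]) (use assms(3) n d2 in \<open>auto simp: new intro!: J\<close>)
  have 2: "route ({g} \<times> {c + 3..c + 1 + d i}) {} (g, c + 1 + d i) (g, c + 3)"
    by (rule line_down) (use assms(3) n d2 in \<open>auto intro!: J\<close>)
  have 3: "route (insert (g, c + 1) ?I \<union> {g} \<times> {c + 3..c + 1 + d i}) (insert i X) (?h, c) (g, c + 3)"
    by (rule route_link[OF 1 2 link_host_eq]) (use assms n d2 g_def in \<open>auto simp: new\<close>)
  have 4: "route ({?h} \<times> {c + 3..c + 1 + d i}) {} (?h, c + 3) (?h, c + 1 + d i)"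
    by (rule line_up) (use assms(3) n d2 in \<open>auto intro!: J\<close>)
  have "route (insert (g, c + 1) ?I \<union> UNIV \<times> {c + 3..c + 1 + d i}) (insert i X) (?h, c) (?h, c + 1 + d i)"
    by (rule route_join[OF 3 4 rung_eq]) (use assms(3) in \<open>auto simp: new\<close>)
  then have "route (insert (g, c + 1) ?I \<union> UNIV \<times> {c + 3..c + 1 + d i}
      \<union> UNIV \<times> {c + 1 + d i + 1..c + 1 + d i + 2 * int n}) (insert i X) (?h, c) (?h, c + 1 + d i + 2 * int n)"
    by (rule extend_zigzag) (use assms(3) n d2 in \<open>auto simp: new intro!: J\<close>)
  moreover have "insert (g, c + 1) ?I \<union> UNIV \<times> {c + 3..c + 1 + d i}
      \<union> UNIV \<times> {c + 1 + d i + 1..c + 1 + d i + 2 * int n} =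
      insert (g, c + 1) ?I \<union> UNIV \<times> {c + 3..c + 1 + d j}"
    using n d2 by auto
  ultimately have "route (insert (g, c + 1) ?I \<union> UNIV \<times> {c + 3..c + 1 + d j}) (insert i X)
      (?h, c) (?h, c + 1 + d j)"
    using n by (simp add: algebra_simps)
  then have "route (insert (?h, c + 2 + d j) (insert (g, c + 1) ?I \<union> UNIV \<times> {c + 3..c + 1 + d j}))
      (insert i X) (?h, c) (?h, c + 2 + d j)" (is "route ?K _ _ _")
    by (rule route_snoc[OF _ rail_eq]) (use assms(3) n d2 in \<open>auto simp: new intro!: J\<close>)
  then have "route ?K (insert i X) (?h, c + 2 + d j) (?h, c)"
    by (rule route_sym)
  then have "route (insert (?h, c + 1) ?K) (insert i X) (?h, c + 2 + d j) (?h, c + 1)"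
    by (rule route_snoc[OF _ rail]) (use assms(3) n d2 in \<open>auto simp: new intro!: J\<close>)
  then have "route (insert (?h, c + 2) (insert (?h, c + 1) ?K)) (insert i X) (?h, c + 2 + d j) (?h, c + 2)"
    by (rule route_snoc[OF _ rail_eq]) (use assms(3) n d2 in \<open>auto simp: new intro!: J\<close>)
  then have "route (insert (g, c + 2) (insert (?h, c + 2) (insert (?h, c + 1) ?K))) (insert i X)
      (?h, c + 2 + d j) (g, c + 2)"
    by (rule route_snoc[OF _ rung_eq]) (use assms(3) n d2 in \<open>auto simp: new intro!: J\<close>)
  then have "route (insert (g, c + 2 + d j) (insert (g, c + 2) (insert (?h, c + 2) (insert (?h, c + 1) ?K))))
      (insert i (insert j X)) (?h, c + 2 + d j) (g, c + 2 + d j)"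
    by (rule route_snoc_link[OF _ link_host_eq, where i = j])
      (use assms n d2 g_def in \<open>auto simp: new intro!: J\<close>)
  moreover have "insert (g, c + 2 + d j) (insert (g, c + 2) (insert (?h, c + 2) (insert (?h, c + 1) ?K)))
      = Z \<union> UNIV \<times> {1..c + 2 + d j}"
    using n d2 assms(3) by (cases g) auto
  ultimately show ?thesis by - (rule frontI[of Z _ _ ?h g], simp_all)
qed

lemma front_odd_chords:
  assumes "front Z X c" "Z \<subseteq> UNIV \<times> {0}" "0 \<le> c" "distinct xs" "set xs \<subseteq> Ids"
    "set xs \<inter> X = {}" "\<forall>i\<in>set xs. odd (d i)" "UNIV \<times> {1..c + (\<Sum>i\<leftarrow>xs. d i + 1)} \<subseteq> J"
  shows "front Z (X \<union> set xs) (c + (\<Sum>i\<leftarrow>xs. d i + 1))"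
  using assms
proof (induction xs arbitrary: c X)
  case Nil
  then show ?case by simp
next
  case (Cons i xs)
  have d: "0 < d i" using length_pos Cons.prems by auto
  have nonneg: "0 \<le> (\<Sum>i\<leftarrow>xs. d i + 1)"
    by (rule sum_list_nonneg) (use length_pos Cons.prems(5) in force)
  have "UNIV \<times> {1..c + 1 + d i} \<subseteq> J"
    by (rule order_trans[OF _ Cons.prems(8)]) (use nonneg in auto)
  then have "front Z (insert i X) (c + 1 + d i)"
    using Cons.prems by (intro front_odd_chord) auto
  from Cons.IH[OF this] show ?case
    using Cons.prems d by (simp add: algebra_simps)
qed

lemma front_even_chords:
  assumes "front Z X c" "Z \<subseteq> UNIV \<times> {0}" "0 \<le> c" "distinct xs" "set xs \<subseteq> Ids"
    "set xs \<inter> X = {}" "\<forall>i\<in>set xs. even (d i) \<and> host i = g" "even (length xs)"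
    "UNIV \<times> {1..c + (\<Sum>i\<leftarrow>xs. d i + 1)} \<subseteq> J"
  shows "\<exists>c'. c \<le> c' \<and> c' \<le> c + (\<Sum>i\<leftarrow>xs. d i + 1) \<and> front Z (X \<union> set xs) c'"
  using assms
proof (induction xs arbitrary: c X rule: induct_list012)
  case 1
  then show ?case by auto
next
  case (2 i)
  then show ?case by simp
next
  case (3 i j xs)
  have d: "0 < d i" "0 < d j" using length_pos 3(7) by auto
  have nonneg: "0 \<le> (\<Sum>i\<leftarrow>xs. d i + 1)"
    by (rule sum_list_nonneg) (use length_pos 3(7) in force)
  obtain i' j' where ij: "{i', j'} = {i, j}" "d i' \<le> d j'" "i' \<noteq> j'"
  proof (cases "d i \<le> d j")
    case True
    then show ?thesis using that[of i j] 3(6) by simp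
  next
    case False
    then show ?thesis using that[of j i] 3(6) by (auto simp: insert_commute)
  qed
  have mem: "i' \<in> set (i # j # xs)" "j' \<in> set (i # j # xs)" using ij(1) by auto
  have max: "d j' \<le> d i + d j" using ij(1) d by (auto simp: doubleton_eq_iff)
  let ?c = "c + 2 + d j'"
  have "UNIV \<times> {1..?c} \<subseteq> J"
    by (rule order_trans[OF _ 3(11)]) (use nonneg max in auto)
  moreover have "host i' = host j'" "even (d i')" "even (d j')" using mem 3(9) by auto
  moreover have "i' \<in> Ids" "j' \<in> Ids" "i' \<notin> X" "j' \<notin> X" using mem 3(7,8) by auto
  ultimately have "front Z (insert i' (insert j' X)) ?c"
    using 3(3-5) ij by (intro front_even_pair) auto
  moreover have "insert i' (insert j' X) = {i, j} \<union> X" using ij(1) by auto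
  ultimately have 1: "front Z ({i, j} \<union> X) ?c" by simp
  have 2: "UNIV \<times> {1..?c + (\<Sum>i\<leftarrow>xs. d i + 1)} \<subseteq> J"
    by (rule order_trans[OF _ 3(11)]) (use max in auto)
  have "\<exists>c'. ?c \<le> c' \<and> c' \<le> ?c + (\<Sum>i\<leftarrow>xs. d i + 1) \<and> front Z ({i, j} \<union> X \<union> set xs) c'"
    by (rule 3(1)[OF 1]) (use 2 3 d length_pos[of j'] \<open>j' \<in> Ids\<close> in auto)
  then obtain c' where "?c \<le> c'" "c' \<le> ?c + (\<Sum>i\<leftarrow>xs. d i + 1)"
      "front Z ({i, j} \<union> X \<union> set xs) c'" by blast
  moreover have "{i, j} \<union> X \<union> set xs = X \<union> set (i # j # xs)" by auto
  ultimately show ?case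
    using max length_pos[OF \<open>j' \<in> Ids\<close>] by (intro exI[of _ c']) simp
qed

section \<open>Closing up the prism\<close>

lemma closed_strand:
  assumes J: "J = UNIV \<times> {0..p - 1}" and per: "\<And>b. q (b, p) = q (b, 0)" and p: "odd p"
    and xs: "distinct xs" "set xs = Ids" "odd (length (filter (\<lambda>i. even (d i)) xs))"
    and len: "(\<Sum>i\<leftarrow>xs. d i + 2) < p"
  shows "\<exists>a b. route J Ids a b \<and> E (q b) (q a)"
proof -
  have nonneg: "0 \<le> (\<Sum>i\<leftarrow>xs. d i + 2)"
    by (rule sum_list_nonneg) (use length_pos xs(2) in force)
  have "route (insert (False, 0) {(True, 0)}) {} (True, 0) (False, 0)"
    by (rule route_snoc[OF route_single rung_eq]) (use J len nonneg in auto)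
  moreover have "insert (False, 0) {(True, 0)} = UNIV \<times> {0..0::int}" by auto
  ultimately have start: "route (UNIV \<times> {0..0}) {} (True, 0) (False, 0)" by simp
  have "\<exists>c' h'. 0 \<le> c' \<and> c' \<le> 0 + (\<Sum>i\<leftarrow>xs. d i + 2) \<and>
    route (UNIV \<times> {0..c'}) ({} \<union> set xs) (True, 0) (h', c') \<and>
    (even (c' - 0 + int (length (filter (\<lambda>i. even (d i)) xs))) \<longleftrightarrow> h' = False)"
    by (rule strand_chords[OF start]) (use J xs len in auto)
  then obtain c h where ch: "0 \<le> c" "c \<le> 0 + (\<Sum>i\<leftarrow>xs. d i + 2)"
    "route (UNIV \<times> {0..c}) ({} \<union> set xs) (True, 0) (h, c)"
    "even (c - 0 + int (length (filter (\<lambda>i. even (d i)) xs))) \<longleftrightarrow> h = False"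
    by blast
  have c: "0 \<le> c" "c < p" "route (UNIV \<times> {0..c}) Ids (True, 0) (h, c)" "odd c \<longleftrightarrow> \<not> h"
    using ch len xs(2,3) by auto
  define n where "n = nat (p - 1 - c)"
  have n: "c + int n = p - 1" using c(2) unfolding n_def by simp
  obtain h' where h': "route (UNIV \<times> {0..c + int n}) Ids (True, 0) (h', c + int n)"
      "even (int n) \<longleftrightarrow> h' = h"
    using strand_columns[OF c(3,1), of n] n J by auto
  \<comment> \<open>The strand begins at \<open>(True, 0)\<close>, and after column \<open>0\<close>
    its end is on rail \<open>False\<close>. The last column \<open>p - 1\<close> is even because
    \<open>p\<close> is odd; the odd number of even chords shifts the parity so that the strand ends
    on rail \<open>True\<close>, where the wrap-around edge meets its start.\<close>
  have "even (c + int n)" using p n by simp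
  then have "even c \<longleftrightarrow> even (int n)" by simp
  then have "h' = True" using c(4) h'(2) by (cases h; cases h') auto
  then have "route J Ids (True, 0) (True, p - 1)" using h'(1) n J by simp
  moreover have "E (q (True, p - 1)) (q (True, 0))"
    using rail[of True "p - 1"] per by simp
  ultimately show ?thesis by blast
qed

lemma closed_front:
  assumes J: "J = UNIV \<times> {0..p - 1}"
    and xs: "distinct (os @ us @ vs)" "set (os @ us @ vs) = Ids"
      "\<forall>i\<in>set os. odd (d i)" "\<forall>i\<in>set us. even (d i) \<and> host i = True"
      "\<forall>i\<in>set vs. even (d i) \<and> host i = False" "even (length us)" "even (length vs)"
    and len: "(\<Sum>i\<leftarrow>os @ us @ vs. d i + 1) < p"
  shows "\<exists>a b. route J Ids a b \<and> E (q b) (q a)"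
proof -
  let ?s = "\<lambda>xs. \<Sum>i\<leftarrow>xs. d i + 1"
  have nonneg: "0 \<le> ?s ys" if "set ys \<subseteq> Ids" for ys
    by (rule sum_list_nonneg) (use length_pos that in force)
  have s: "0 \<le> ?s os" "0 \<le> ?s us" "0 \<le> ?s vs" "?s os + ?s us + ?s vs < p"
    using nonneg[of os] nonneg[of us] nonneg[of vs] xs(2) len by auto
  let ?Z = "UNIV \<times> {0::int}"
  have J': "UNIV \<times> {1..x} \<subseteq> J" if "x < p" for x
    using that J by auto
  have "route (insert (False, 0) {(True, 0)}) {} (True, 0) (False, 0)"
    by (rule route_snoc[OF route_single rung_eq]) (use J s in auto)
  moreover have "insert (False, 0) {(True, 0)} = ?Z \<union> UNIV \<times> {1..0}" by auto
  ultimately have 0: "front ?Z {} 0" unfolding front_def by simp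
  have 1: "front ?Z ({} \<union> set os) (0 + ?s os)"
    by (rule front_odd_chords[OF 0]) (use xs J'[of "?s os"] s in auto)
  have "\<exists>c'. 0 + ?s os \<le> c' \<and> c' \<le> 0 + ?s os + ?s us \<and> front ?Z ({} \<union> set os \<union> set us) c'"
    by (rule front_even_chords[OF 1]) (use xs J'[of "?s os + ?s us"] s in auto)
  then obtain c where c: "?s os \<le> c" "c \<le> ?s os + ?s us" "front ?Z (set os \<union> set us) c"
    by auto
  have "\<exists>c'. c \<le> c' \<and> c' \<le> c + ?s vs \<and> front ?Z (set os \<union> set us \<union> set vs) c'"
    by (rule front_even_chords[OF c(3)]) (use xs J'[of "c + ?s vs"] s c in auto)
  moreover have "set os \<union> set us \<union> set vs = Ids" using xs(2) by auto
  ultimately obtain c' where c': "c \<le> c'" "c' \<le> c + ?s vs" "front ?Z Ids c'"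
    by auto
  have "front ?Z Ids (p - 1)"
    by (rule front_columns[OF c'(3)]) (use c c' s J'[of "p - 1"] in auto)
  moreover have "?Z \<union> UNIV \<times> {1..p - 1} = J" using J s by auto
  ultimately have "route J Ids (True, p - 1) (False, p - 1)" unfolding front_def by simp
  moreover have "E (q (False, p - 1)) (q (True, p - 1))" by (rule rung_eq) simp
  ultimately show ?thesis by blast
qed

text \<open>The path runs from \<open>(True, d i)\<close> along the chord to
  \<open>(True, 0)\<close>, then through \<open>(True, 1)\<close> and \<open>(False, 1)\<close>, and
  zigzags over the \<open>d i - 2\<close> columns up to \<open>d i - 1\<close> before it steps to
  \<open>(False, d i)\<close>. Leaving out \<open>(False, 0)\<close> is what makes a single even
  chord fit.\<close>

lemma front_start:
  assumes "i \<in> Ids" "host i = True" "even (d i)" "insert (True, 0) (UNIV \<times> {1..d i}) \<subseteq> J"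
  shows "front {(True, 0)} {i} (d i)"
proof -
  have d2: "2 \<le> d i" using length_pos[OF assms(1)] assms(3) by presburger
  obtain n where n: "d i = 2 + 2 * int n"
  proof -
    obtain k where "d i = 2 * k" using assms(3) by (rule evenE)
    with d2 show ?thesis by (intro that[of "nat (k - 1)"]) auto
  qed
  have J: "(x, y) \<in> J" if "1 \<le> y" "y \<le> d i" for x y
    using assms(4) that by auto
  have "route {(True, d i)} {} (True, d i) (True, d i)"
    by (rule route_single) (use J d2 in auto)
  then have "route (insert (True, 0) {(True, d i)}) {i} (True, d i) (True, 0)"
    by (rule route_snoc_link[OF _ link_host_down]) (use assms d2 in auto)
  then have "route (insert (True, 1) (insert (True, 0) {(True, d i)})) {i} (True, d i) (True, 1)"
    by (rule route_snoc[OF _ rail_eq]) (use J d2 in auto)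
  then have "route (insert (False, 1) (insert (True, 1) (insert (True, 0) {(True, d i)}))) {i}
      (True, d i) (False, 1)"
    by (rule route_snoc[OF _ rung_eq]) (use J d2 in auto)
  then have "route (insert (False, 1) (insert (True, 1) (insert (True, 0) {(True, d i)}))
      \<union> UNIV \<times> {1 + 1..1 + 2 * int n}) {i} (True, d i) (False, 1 + 2 * int n)"
    by (rule extend_zigzag) (use J n in auto)
  then have "route (insert (False, d i) (insert (False, 1) (insert (True, 1) (insert (True, 0) {(True, d i)}))
      \<union> UNIV \<times> {1 + 1..1 + 2 * int n})) {i} (True, d i) (False, d i)"
    by (rule route_snoc[OF _ rail_eq]) (use J n in auto)
  moreover have "insert (False, d i) (insert (False, 1) (insert (True, 1) (insert (True, 0) {(True, d i)}))
      \<union> UNIV \<times> {1 + 1..1 + 2 * int n}) = {(True, 0)} \<union> UNIV \<times> {1..d i}"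
    using n by auto
  ultimately show ?thesis unfolding front_def by simp
qed

text \<open>Counterpart of the opening: one strand steps to \<open>(False, c + 1)\<close> and takes
  the chord to \<open>(False, p)\<close>. The other goes through \<open>(True, c + 1)\<close> and
  \<open>(True, c + 2)\<close>, crosses to rail \<open>False\<close> and zigzags over the remaining
  \<open>d i - 2\<close> columns up to \<open>(False, p - 1)\<close>, next to the end of the
  first.\<close>

lemma front_finish:
  assumes "front {(True, 0)} X c" "0 \<le> c" "c + 1 + d i = p" "i \<in> Ids" "i \<notin> X"
    "host i = False" "even (d i)" and J: "J = {(True, 0), (False, p)} \<union> UNIV \<times> {1..p - 1}"
  shows "\<exists>a b. route J (insert i X) a b \<and> E (q b) (q a)"
proof -
  have d2: "2 \<le> d i" using length_pos[OF assms(4)] assms(7) by presburger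
  obtain n where n: "d i = 2 + 2 * int n"
  proof -
    obtain k where "d i = 2 * k" using assms(7) by (rule evenE)
    with d2 show ?thesis by (intro that[of "nat (k - 1)"]) auto
  qed
  have p: "p = c + 3 + 2 * int n" using n assms(3) by simp
  let ?I = "{(True, 0)} \<union> UNIV \<times> {1..c}"
  have "route ?I X (True, c) (False, c)" using assms(1) unfolding front_def .
  then have "route (insert (False, c + 1) ?I) X (True, c) (False, c + 1)"
    by (rule route_snoc[OF _ rail]) (use assms(2) p J in auto)
  then have "route (insert (False, p) (insert (False, c + 1) ?I)) (insert i X) (True, c) (False, p)"
    by (rule route_snoc_link[OF _ link_host_eq]) (use assms(2-6) n p J in auto)
  then have "route (insert (True, c + 1) (insert (False, p) (insert (False, c + 1) ?I))) (insert i X)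
      (False, p) (True, c + 1)"
    by (rule route_snoc[OF route_sym rail]) (use assms(2) p J in auto)
  then have "route (insert (True, c + 2) (insert (True, c + 1) (insert (False, p) (insert (False, c + 1) ?I))))
      (insert i X) (False, p) (True, c + 2)"
    by (rule route_snoc[OF _ rail_eq]) (use assms(2) p J in auto)
  then have "route (insert (False, c + 2) (insert (True, c + 2) (insert (True, c + 1) (insert (False, p)
      (insert (False, c + 1) ?I))))) (insert i X) (False, p) (False, c + 2)"
    by (rule route_snoc[OF _ rung_eq]) (use assms(2) p J in auto)
  then have "route (insert (False, c + 2) (insert (True, c + 2) (insert (True, c + 1) (insert (False, p)
      (insert (False, c + 1) ?I)))) \<union> UNIV \<times> {c + 2 + 1..c + 2 + 2 * int n}) (insert i X)
      (False, p) (False, c + 2 + 2 * int n)"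
    by (rule extend_zigzag) (use assms(2) p J in auto)
  moreover have "insert (False, c + 2) (insert (True, c + 2) (insert (True, c + 1) (insert (False, p)
      (insert (False, c + 1) ?I)))) \<union> UNIV \<times> {c + 2 + 1..c + 2 + 2 * int n} = J"
    unfolding J using p assms(2) by auto
  moreover have "c + 2 + 2 * int n = p - 1" using p by simp
  ultimately have "route J (insert i X) (False, p) (False, p - 1)" by simp
  moreover have "E (q (False, p - 1)) (q (False, p))" by (rule rail_eq) simp
  ultimately show ?thesis by blast
qed

text \<open>In the ragged case, \<open>(False, p)\<close> stands for the vertex \<open>(False, 0)\<close> of the prism: the path
  starts from \<open>(True, 0)\<close> without it and reaches it only at the end, through the chord \<open>v\<close>.\<close>

lemma closed_ragged_front:
  assumes J: "J = {(True, 0), (False, p)} \<union> UNIV \<times> {1..p - 1}"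
    and xs: "distinct (u # v # os @ us @ vs)" "set (u # v # os @ us @ vs) = Ids"
      "\<forall>i\<in>set os. odd (d i)" "\<forall>i\<in>set (u # us). even (d i) \<and> host i = True"
      "\<forall>i\<in>set (v # vs). even (d i) \<and> host i = False" "even (length us)" "even (length vs)"
    and len: "(\<Sum>i\<leftarrow>u # v # os @ us @ vs. d i + 1) < p"
  shows "\<exists>a b. route J Ids a b \<and> E (q b) (q a)"
proof -
  let ?s = "\<lambda>xs. \<Sum>i\<leftarrow>xs. d i + 1"
  have nonneg: "0 \<le> ?s ys" if "set ys \<subseteq> Ids" for ys
    by (rule sum_list_nonneg) (use length_pos that in force)
  have uv: "u \<in> Ids" "v \<in> Ids" using xs(2) by auto
  have s: "0 \<le> ?s os" "0 \<le> ?s us" "0 \<le> ?s vs" "0 < d u" "0 < d v"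
      "d u + d v + 2 + ?s os + ?s us + ?s vs < p"
    using nonneg[of os] nonneg[of us] nonneg[of vs] xs(2) len length_pos[OF uv(1)] length_pos[OF uv(2)]
    by auto
  let ?Z = "{(True, 0::int)}"
  have J': "UNIV \<times> {1..x} \<subseteq> J" if "x < p" for x
    using that J by auto
  have 0: "front ?Z {u} (d u)"
    by (rule front_start) (use xs uv J'[of "d u"] J s in auto)
  have 1: "front ?Z ({u} \<union> set os) (d u + ?s os)"
    by (rule front_odd_chords[OF 0]) (use xs J'[of "d u + ?s os"] s in auto)
  have "\<exists>c'. d u + ?s os \<le> c' \<and> c' \<le> d u + ?s os + ?s us \<and> front ?Z ({u} \<union> set os \<union> set us) c'"
    by (rule front_even_chords[OF 1]) (use xs J'[of "d u + ?s os + ?s us"] s in auto)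
  then obtain c where c: "d u + ?s os \<le> c" "c \<le> d u + ?s os + ?s us"
      "front ?Z ({u} \<union> set os \<union> set us) c"
    by blast
  have "\<exists>c'. c \<le> c' \<and> c' \<le> c + ?s vs \<and> front ?Z ({u} \<union> set os \<union> set us \<union> set vs) c'"
    by (rule front_even_chords[OF c(3)]) (use xs J'[of "c + ?s vs"] s c in auto)
  then obtain c' where c': "c \<le> c'" "c' \<le> c + ?s vs"
      "front ?Z ({u} \<union> set os \<union> set us \<union> set vs) c'"
    by blast
  \<comment> \<open>Plain columns are added up to \<open>p - 1 - d v\<close>, so that the chord
    \<open>v\<close>, which starts one column further on, ends exactly in column
    \<open>p\<close>.\<close>
  have 2: "front ?Z ({u} \<union> set os \<union> set us \<union> set vs) (p - 1 - d v)"
    by (rule front_columns[OF c'(3)]) (use c c' s J'[of "p - 1 - d v"] in auto)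
  have "\<exists>a b. route J (insert v ({u} \<union> set os \<union> set us \<union> set vs)) a b \<and> E (q b) (q a)"
    by (rule front_finish[OF 2 _ _ _ _ _ _ J]) (use xs uv s in auto)
  moreover have "insert v ({u} \<union> set os \<union> set us \<union> set vs) = Ids" using xs(2) by auto
  ultimately show ?thesis by simp
qed

end

section \<open>A single rail with chords\<close>

text \<open>Coordinate \<open>x\<close> stands for the point of a fibre reached after
  \<open>x\<close> steps of size \<open>k\<close>, so that consecutive coordinates are adjacent. The
  length \<open>\<mu> i\<close> of a chord is measured in these steps; \<open>k * \<mu> i\<close> is
  its displacement in the fibre, which is bounded by \<open>B\<close> modulo
  \<open>p\<close>.\<close>

locale rails = chorded E q J S Ids
  for E :: "'a \<Rightarrow> 'a \<Rightarrow> bool" and q :: "int \<Rightarrow> 'a" and J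
    and S :: "'i \<Rightarrow> 'a set" and Ids +
  fixes \<mu> :: "'i \<Rightarrow> int" and p k B :: int
  assumes nodes: "J = {0..<p}"
    and rail: "E (q x) (q (x + 1))"
    and wrap: "E (q 0) (q (p - 1))"
    and link_shift: "i \<in> Ids \<Longrightarrow> 0 \<le> x \<Longrightarrow> x + \<mu> i < p \<Longrightarrow> link i x (x + \<mu> i)"
    and pos: "i \<in> Ids \<Longrightarrow> 1 \<le> \<mu> i"
    and step_bound: "\<bar>k\<bar> \<le> B"
    and shift_bound: "i \<in> Ids \<Longrightarrow> \<exists>D. \<bar>D\<bar> \<le> B \<and> p dvd k * \<mu> i - D"
begin

text \<open>Here \<open>x\<close> steps along the rail make a displacement in the fibre that is
  bounded modulo \<open>p\<close>, however large \<open>x\<close> itself is. The number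
  \<open>n\<close> counts bounded summands, so that sums are handled by adding counts.\<close>

definition small :: "nat \<Rightarrow> int \<Rightarrow> bool" where
  "small n x \<longleftrightarrow> (\<exists>D. \<bar>D\<bar> \<le> int n * B \<and> p dvd k * x - D)"

lemma B_nonneg: "0 \<le> B"
  using step_bound by linarith

lemma small_add: "small m x \<Longrightarrow> small n y \<Longrightarrow> small (m + n) (x + y)"
proof -
  assume "small m x" "small n y"
  then obtain D D' where D: "\<bar>D\<bar> \<le> int m * B" "p dvd k * x - D" "\<bar>D'\<bar> \<le> int n * B" "p dvd k * y - D'"
    unfolding small_def by blast
  have "p dvd (k * x - D) + (k * y - D')" using D by (intro dvd_add)
  moreover have "\<bar>D + D'\<bar> \<le> int (m + n) * B"
    using D(1,3) by (simp add: algebra_simps abs_le_iff)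
  ultimately show ?thesis
    unfolding small_def by (intro exI[of _ "D + D'"]) (simp add: algebra_simps)
qed

lemma small_uminus: "small n x \<Longrightarrow> small n (- x)"
proof -
  assume "small n x"
  then obtain D where D: "\<bar>D\<bar> \<le> int n * B" "p dvd k * x - D"
    unfolding small_def by blast
  have "p dvd - (k * x - D)" using D(2) by (subst dvd_minus_iff)
  then show ?thesis
    unfolding small_def using D(1) by (intro exI[of _ "- D"]) (simp add: algebra_simps)
qed

lemma small_diff: "small m x \<Longrightarrow> small n y \<Longrightarrow> small (m + n) (x - y)"
  using small_add[OF _ small_uminus] by fastforce

lemma small_1: "small 1 1"
  unfolding small_def using step_bound by (intro exI[of _ k]) simp

lemma small_0: "small 0 0"
  unfolding small_def by (intro exI[of _ 0]) simp

lemma small_p: "small 0 p"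
  unfolding small_def by (intro exI[of _ 0]) simp

lemma small_mu: "i \<in> Ids \<Longrightarrow> small 1 (\<mu> i)"
  unfolding small_def using shift_bound by simp

lemma small_mono: "small m x \<Longrightarrow> m \<le> n \<Longrightarrow> small n x"
  unfolding small_def using B_nonneg
  by (meson order_trans mult_right_mono of_nat_le_iff)

section \<open>Stretches of the rail and path rotations\<close>

definition seg :: "(int \<Rightarrow> int) \<Rightarrow> int \<Rightarrow> bool" where
  "seg f L \<longleftrightarrow> inj_on f {0..<L} \<and> f ` {0..<L} \<subseteq> J \<and>
     (\<forall>i. 0 \<le> i \<and> i + 1 < L \<longrightarrow> E (q (f i)) (q (f (i + 1)))) \<and>
     (\<forall>c\<in>Ids. \<forall>x. 0 \<le> x \<and> x + \<mu> c < L \<longrightarrow> link c (f x) (f (x + \<mu> c)))"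

lemma seg_rail: "seg f L \<Longrightarrow> 0 \<le> i \<Longrightarrow> i < L \<Longrightarrow> 0 \<le> j \<Longrightarrow> j < L \<Longrightarrow> \<bar>i - j\<bar> = 1 \<Longrightarrow> E (q (f i)) (q (f j))"
proof -
  assume *: "seg f L" "0 \<le> i" "i < L" "0 \<le> j" "j < L" "\<bar>i - j\<bar> = 1"
  then consider "j = i + 1" | "i = j + 1" by linarith
  then show ?thesis using * sym unfolding seg_def by cases auto
qed

lemma seg_link: "seg f L \<Longrightarrow> c \<in> Ids \<Longrightarrow> 0 \<le> i \<Longrightarrow> i < L \<Longrightarrow> 0 \<le> j \<Longrightarrow> j < L \<Longrightarrow> \<bar>i - j\<bar> = \<mu> c
  \<Longrightarrow> link c (f i) (f j)"
proof -
  assume *: "seg f L" "c \<in> Ids" "0 \<le> i" "i < L" "0 \<le> j" "j < L" "\<bar>i - j\<bar> = \<mu> c"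
  then consider "j = i + \<mu> c" | "i = j + \<mu> c" by linarith
  then show ?thesis using * link_sym unfolding seg_def by cases auto
qed

lemma seg_disjoint: "seg f L \<Longrightarrow> A \<subseteq> {0..<L} \<Longrightarrow> A' \<subseteq> {0..<L} \<Longrightarrow> A \<inter> A' = {} \<Longrightarrow> f ` A \<inter> f ` A' = {}"
  unfolding seg_def using inj_on_image_Int[of f "{0..<L}" A A'] by simp

lemma seg_node: "seg f L \<Longrightarrow> 0 \<le> i \<Longrightarrow> i < L \<Longrightarrow> f i \<in> J"
  unfolding seg_def by auto

lemma seg_fresh: "seg f L \<Longrightarrow> A \<subseteq> {0..<L} \<Longrightarrow> 0 \<le> i \<Longrightarrow> i < L \<Longrightarrow> i \<notin> A \<Longrightarrow> f i \<notin> f ` A"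
  using seg_disjoint[of f L A "{i}"] by auto

lemma seg_line:
  assumes "seg f L" "0 \<le> a" "a \<le> b" "b < L"
  shows "route (f ` {a..b}) {} (f a) (f b)"
  using assms(3,4)
proof (induction b rule: int_ge_induct)
  case base
  then show ?case using route_single[OF seg_node[OF assms(1,2)]] by simp
next
  case (step i)
  have 1: "route (f ` {a..i}) {} (f a) (f i)" using step by simp
  have 2: "E (q (f i)) (q (f (i + 1)))"
    by (rule seg_rail[OF assms(1)]) (use step assms in auto)
  have 3: "f (i + 1) \<in> J" by (rule seg_node[OF assms(1)]) (use step assms in auto)
  have 4: "f (i + 1) \<notin> f ` {a..i}"
    by (rule seg_fresh[OF assms(1)]) (use step assms in auto)
  have 5: "{a..i + 1} = insert (i + 1) {a..i}" using step by auto
  show ?case by (rule route_snoc[OF 1 2 3 4]) (simp add: 5)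
qed

text \<open>The path on \<open>{0..R - 1}\<close> starts next to the rest of the rail and ends one step further back;
  a chord from that end to \<open>R - 2 + \<mu> i\<close> restores this shape with a larger \<open>R\<close>.\<close>

lemma seg_tail:
  assumes "seg f L" "distinct xs" "set xs \<subseteq> Ids" "\<forall>i\<in>set xs. 2 \<le> \<mu> i"
    "R = 2 + (\<Sum>i\<leftarrow>xs. \<mu> i - 1)" "R \<le> L"
  shows "route (f ` {0..R - 1}) (set xs) (f (R - 1)) (f (R - 2))"
  using assms(2-)
proof (induction xs arbitrary: R)
  case Nil
  have "route (f ` {0..1}) {} (f 1) (f 0)"
    by (rule route_sym[OF seg_line[OF assms(1)]]) (use Nil in auto)
  then show ?case using Nil by simp
next
  case (Cons i xs)
  define R' where "R' = 2 + (\<Sum>i\<leftarrow>xs. \<mu> i - 1)"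
  define z where "z = R' - 2 + \<mu> i"
  have "0 \<le> (\<Sum>i\<leftarrow>xs. \<mu> i - 1)"
    by (rule sum_list_nonneg) (use Cons.prems(3) in force)
  then have R': "2 \<le> R'" unfolding R'_def by simp
  have m: "2 \<le> \<mu> i" and i: "i \<in> Ids" "i \<notin> set xs" using Cons.prems by auto
  have R: "R = z + 1" using Cons.prems(4) unfolding z_def R'_def by simp
  then have zL: "z < L" using Cons.prems(5) by simp
  have z: "R' \<le> z" using m unfolding z_def by simp
  have IH: "route (f ` {0..R' - 1}) (set xs) (f (R' - 2)) (f (R' - 1))"
    by (rule route_sym[OF Cons.IH]) (use Cons.prems R'_def z zL in auto)
  have 1: "route {f z} {} (f z) (f z)"
    by (rule route_single[OF seg_node[OF assms(1)]]) (use z R' zL in auto)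
  have 2: "link i (f z) (f (R' - 2))"
    by (rule seg_link[OF assms(1) i(1)]) (use z R' zL m in \<open>auto simp: z_def\<close>)
  have "f z \<notin> f ` {0..R' - 1}"
    by (rule seg_fresh[OF assms(1)]) (use z R' zL in auto)
  then have 3: "route (f ` insert z {0..R' - 1}) (insert i (set xs)) (f z) (f (R' - 1))"
    by (intro route_link[OF 1 IH 2 i(1)]) (use i in auto)
  show ?case
  proof (cases "z = R'")
    case True
    have "insert z {0..R' - 1} = {0..R - 1}" using True R R' by auto
    then show ?thesis using 3 R True by simp
  next
    case False
    have 4: "route (f ` {R'..z - 1}) {} (f R') (f (z - 1))"
      by (rule seg_line[OF assms(1)]) (use False z R' zL in auto)
    have 5: "E (q (f (R' - 1))) (q (f R'))"
      by (rule seg_rail[OF assms(1)]) (use z R' zL in auto)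
    have "{0..R - 1} = insert z {0..R' - 1} \<union> {R'..z - 1}" using R R' z by auto
    then have 6: "f ` {0..R - 1} = f ` insert z {0..R' - 1} \<union> f ` {R'..z - 1}"
      by (metis image_Un)
    have 7: "f ` insert z {0..R' - 1} \<inter> f ` {R'..z - 1} = {}"
      by (rule seg_disjoint[OF assms(1)]) (use z R' zL in auto)
    have "route (f ` {0..R - 1}) (insert i (set xs)) (f z) (f (z - 1))"
      by (rule route_join[OF 3 4 5 7 _ 6]) auto
    then show ?thesis using R by simp
  qed
qed

text \<open>A chord with \<open>\<mu> i = 1\<close> joins consecutive coordinates, so it can take
  the place of the next rail edge beyond the part already covered.\<close>

lemma seg_tail_unit:
  assumes "seg f L" "route (f ` {0..R - 1}) X (f (R - 1)) y" "1 \<le> R"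
    "distinct xs" "set xs \<subseteq> Ids" "set xs \<inter> X = {}" "\<forall>i\<in>set xs. \<mu> i = 1" "R + int (length xs) \<le> L"
  shows "route (f ` {0..R + int (length xs) - 1}) (X \<union> set xs) (f (R + int (length xs) - 1)) y"
  using assms(4-)
proof (induction xs)
  case Nil
  then show ?case using assms(2) by simp
next
  case (Cons i xs)
  let ?R = "R + int (length xs)"
  have IH: "route (f ` {0..?R - 1}) (X \<union> set xs) (f (?R - 1)) y"
    using Cons by simp
  have 1: "route {f ?R} {} (f ?R) (f ?R)"
    by (rule route_single[OF seg_node[OF assms(1)]]) (use Cons.prems assms(3) in auto)
  have 2: "link i (f ?R) (f (?R - 1))"
    by (rule seg_link[OF assms(1)]) (use Cons.prems assms(3) in auto)
  have "{0..?R} = insert ?R {0..?R - 1}" using assms(3) by auto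
  then have 3: "f ` {0..?R} = {f ?R} \<union> f ` {0..?R - 1}" by auto
  have "f ?R \<notin> f ` {0..?R - 1}"
    by (rule seg_fresh[OF assms(1)]) (use Cons.prems assms(3) in auto)
  then have "route (f ` {0..?R}) (insert i (X \<union> set xs)) (f ?R) y"
    by (intro route_link[OF 1 IH 2 _ _ _ _ _ 3]) (use Cons.prems in auto)
  then show ?case by (simp add: algebra_simps)
qed

lemma small_sum:
  "set xs \<subseteq> Ids \<Longrightarrow> small (2 * length xs) (\<Sum>i\<leftarrow>xs. \<mu> i - 1)"
proof (induction xs)
  case Nil
  then show ?case using small_0 by simp
next
  case (Cons i xs)
  have "small (1 + 1 + 2 * length xs) (\<mu> i - 1 + (\<Sum>i\<leftarrow>xs. \<mu> i - 1))"
    using Cons by (intro small_add small_diff small_mu small_1) auto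
  then show ?case by simp
qed

text \<open>Near index \<open>0\<close> the chords with \<open>2 \<le> \<mu> i\<close> are inserted
  by rotations, then the unit chords in place of rail edges, and the rest of the stretch is plain
  rail. The inner end is \<open>R - 2\<close>, a sum of terms \<open>\<mu> i - 1\<close>, and
  therefore small.\<close>

lemma seg_small:
  assumes "seg f L" "distinct xs" "set xs \<subseteq> Ids" "2 + (\<Sum>i\<leftarrow>xs. \<mu> i) < L"
  shows "\<exists>t. 0 \<le> t \<and> t < L \<and> small (2 * length xs) t \<and>
    route (f ` {0..L - 1}) (set xs) (f (L - 1)) (f t)"
proof -
  define ys where "ys = filter (\<lambda>i. 2 \<le> \<mu> i) xs"
  define zs where "zs = filter (\<lambda>i. \<not> 2 \<le> \<mu> i) xs"
  define R where "R = 2 + (\<Sum>i\<leftarrow>ys. \<mu> i - 1)"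
  define R' where "R' = R + int (length zs)"
  have ys: "distinct ys" "set ys \<subseteq> Ids" "\<forall>i\<in>set ys. 2 \<le> \<mu> i"
    and zs: "distinct zs" "set zs \<subseteq> Ids" "\<forall>i\<in>set zs. \<mu> i = 1"
    and yz: "set zs \<inter> set ys = {}" "set ys \<union> set zs = set xs"
    using assms(2,3) pos unfolding ys_def zs_def by force+
  have nonneg: "0 \<le> (\<Sum>i\<leftarrow>ys. \<mu> i - 1)"
    by (rule sum_list_nonneg) (use ys(3) in force)
  have "(\<Sum>i\<leftarrow>ys. \<mu> i - 1) + int (length zs) \<le> (\<Sum>i\<leftarrow>xs. \<mu> i)"
    using assms(3) unfolding ys_def zs_def
    by (induction xs) (use pos in \<open>auto, force+\<close>)
  then have L: "R' < L" using assms(4) unfolding R'_def R_def by simp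
  have R2: "2 \<le> R" "R \<le> R'" using nonneg unfolding R_def R'_def by auto
  have 1: "route (f ` {0..R - 1}) (set ys) (f (R - 1)) (f (R - 2))"
    by (rule seg_tail[OF assms(1) ys R_def]) (use L R2 in simp)
  have "route (f ` {0..R' - 1}) (set ys \<union> set zs) (f (R' - 1)) (f (R - 2))"
    unfolding R'_def by (rule seg_tail_unit[OF assms(1) 1 _ zs(1,2) yz(1) zs(3)])
      (use L R2 in \<open>auto simp: R'_def\<close>)
  then have 2: "route (f ` {0..R' - 1}) (set xs) (f (R' - 1)) (f (R - 2))"
    using yz(2) by simp
  have 3: "route (f ` {R'..L - 1}) {} (f (L - 1)) (f R')"
    by (rule route_sym[OF seg_line[OF assms(1)]]) (use L R2 in auto)
  have 4: "E (q (f R')) (q (f (R' - 1)))"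
    by (rule seg_rail[OF assms(1)]) (use L R2 in auto)
  have "{0..L - 1} = {R'..L - 1} \<union> {0..R' - 1}" using L R2 by auto
  then have 5: "f ` {0..L - 1} = f ` {R'..L - 1} \<union> f ` {0..R' - 1}" by (metis image_Un)
  have 6: "f ` {R'..L - 1} \<inter> f ` {0..R' - 1} = {}"
    by (rule seg_disjoint[OF assms(1)]) (use L R2 in auto)
  have "route (f ` {0..L - 1}) (set xs) (f (L - 1)) (f (R - 2))"
    by (rule route_join[OF 3 2 4 6 _ 5]) auto
  moreover have "small (2 * length xs) (R - 2)"
    using small_mono[OF small_sum[OF ys(2)], of "2 * length xs"] unfolding R_def ys_def by simp
  ultimately show ?thesis using L R2 by (intro exI[of _ "R - 2"]) auto
qed

text \<open>The path descends from \<open>L - 1\<close> to \<open>\<mu> i\<close> for the longest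
  chord \<open>i\<close>, jumps to \<open>0\<close> and enters \<open>{1..\<mu> i - 1}\<close> at
  \<open>1\<close>, which is the same situation read backwards on a shorter stretch. The gap of two
  between the lengths makes the next chord fit there; the chords \<open>xs\<close> are absorbed in
  the innermost stretch.\<close>

lemma seg_spiral:
  assumes "seg f L" "distinct (os @ xs)" "set (os @ xs) \<subseteq> Ids"
    "sorted_wrt (\<lambda>i j. \<mu> j + 2 \<le> \<mu> i) os" "\<forall>i\<in>set os. \<mu> i < L"
    "2 + (\<Sum>i\<leftarrow>xs. \<mu> i) < L" "\<forall>i\<in>set os. 3 + (\<Sum>i\<leftarrow>xs. \<mu> i) < \<mu> i"
  shows "\<exists>t. 0 \<le> t \<and> t < L \<and> small (2 * length (os @ xs)) t \<and>
    route (f ` {0..L - 1}) (set (os @ xs)) (f (L - 1)) (f t)"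
  using assms
proof (induction os arbitrary: f L)
  case Nil
  then show ?case using seg_small[of f L xs] by simp
next
  case (Cons i os)
  let ?m = "\<mu> i" and ?g = "\<lambda>j. f (\<mu> i - 1 - j)"
  have "0 \<le> (\<Sum>i\<leftarrow>xs. \<mu> i)"
    by (rule sum_list_nonneg) (use pos Cons.prems(3) in force)
  then have m: "3 < ?m" "?m < L" "i \<in> Ids" using Cons.prems by auto
  \<comment> \<open>The reflection sends the last index \<open>?m - 2\<close> to \<open>f 1\<close>,
    so the shorter stretch is entered at its last index, as the induction hypothesis
    requires.\<close>
  have g: "seg ?g (?m - 1)"
    unfolding seg_def
  proof (intro conjI allI ballI impI)
    show "inj_on ?g {0..<?m - 1}"
    proof (rule inj_onI)
      fix x y assume xy: "x \<in> {0..<?m - 1}" "y \<in> {0..<?m - 1}" "?g x = ?g y"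
      have "inj_on f {0..<L}" using Cons.prems(1) unfolding seg_def by blast
      from inj_onD[OF this xy(3)] show "x = y" using xy m by auto
    qed
    show "?g ` {0..<?m - 1} \<subseteq> J"
      using seg_node[OF Cons.prems(1)] m by auto
    show "E (q (?g j)) (q (?g (j + 1)))" if "0 \<le> j \<and> j + 1 < ?m - 1" for j
      by (rule seg_rail[OF Cons.prems(1)]) (use that m in auto)
    show "link c (?g x) (?g (x + \<mu> c))" if "c \<in> Ids" "0 \<le> x \<and> x + \<mu> c < ?m - 1" for c x
      by (rule seg_link[OF Cons.prems(1)]) (use that m pos[of c] in auto)
  qed
  have h4: "\<forall>j\<in>set os. \<mu> j < ?m - 1" using Cons.prems(4) by force
  have h5: "3 + (\<Sum>i\<leftarrow>xs. \<mu> i) < ?m" using Cons.prems(7) by simp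
  have IH: "\<exists>t. 0 \<le> t \<and> t < ?m - 1 \<and> small (2 * length (os @ xs)) t \<and>
    route (?g ` {0..?m - 1 - 1}) (set (os @ xs)) (?g (?m - 1 - 1)) (?g t)"
    by (rule Cons.IH[OF g]) (use Cons.prems h4 h5 in simp_all)
  then obtain t where t: "0 \<le> t" "t < ?m - 1" "small (2 * length (os @ xs)) t"
    "route (?g ` {0..?m - 1 - 1}) (set (os @ xs)) (f 1) (?g t)"
    by auto
  have "?g ` {0..?m - 1 - 1} = f ` ((\<lambda>j. ?m - 1 - j) ` {0..?m - 1 - 1})"
    by (simp only: image_image)
  also have "(\<lambda>j. ?m - 1 - j) ` {0..?m - 1 - 1} = {1..?m - 1}"
    using image_diff_atLeastAtMost[of "?m - 1" 0 "?m - 1 - 1"] by simp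
  finally have 1: "route (f ` {1..?m - 1}) (set (os @ xs)) (f 1) (?g t)" using t(4) by simp
  have 2: "route {f 0} {} (f 0) (f 0)"
    by (rule route_single[OF seg_node[OF Cons.prems(1)]]) (use m in auto)
  have "E (q (f 0)) (q (f 1))"
    by (rule seg_rail[OF Cons.prems(1)]) (use m in auto)
  moreover have "f 0 \<notin> f ` {1..?m - 1}"
    by (rule seg_fresh[OF Cons.prems(1)]) (use m in auto)
  ultimately have 3: "route ({f 0} \<union> f ` {1..?m - 1}) (set (os @ xs)) (f 0) (?g t)"
    by (intro route_join[OF 2 1]) auto
  have 4: "route (f ` {?m..L - 1}) {} (f (L - 1)) (f ?m)"
    by (rule route_sym[OF seg_line[OF Cons.prems(1)]]) (use m in auto)
  have 5: "link i (f ?m) (f 0)"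
    by (rule seg_link[OF Cons.prems(1)]) (use m in auto)
  have i: "i \<notin> set (os @ xs)" using Cons.prems(2) by auto
  have "{0..L - 1} = {?m..L - 1} \<union> ({0} \<union> {1..?m - 1})" using m by auto
  then have 6: "f ` {0..L - 1} = f ` {?m..L - 1} \<union> ({f 0} \<union> f ` {1..?m - 1})" by auto
  have "f ` {?m..L - 1} \<inter> f ` insert 0 {1..?m - 1} = {}"
    by (rule seg_disjoint[OF Cons.prems(1)]) (use m in auto)
  then have 7: "f ` {?m..L - 1} \<inter> ({f 0} \<union> f ` {1..?m - 1}) = {}" by simp
  have "route (f ` {0..L - 1}) (insert i ({} \<union> set (os @ xs))) (f (L - 1)) (?g t)"
    by (rule route_link[OF 4 3 5 m(3) 7 _ _ i 6]) auto
  moreover have "small (1 + 1 + 2 * length (os @ xs)) (?m - 1 - t)"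
    using m(3) t(3) by (intro small_diff small_mu small_1)
  ultimately show ?case
    using t m by (intro exI[of _ "?m - 1 - t"]) auto
qed

section \<open>Clean stretches and pairs of almost equal chords\<close>

lemma rail_adj: "\<bar>x - y\<bar> = 1 \<Longrightarrow> E (q x) (q y)"
proof -
  assume "\<bar>x - y\<bar> = 1"
  then consider "y = x + 1" | "x = y + 1" by linarith
  then show ?thesis
  proof cases
    case 1
    then show ?thesis using rail[of x] by simp
  next
    case 2
    then show ?thesis using sym[OF rail[of y]] by simp
  qed
qed

lemma link_adj:
  "i \<in> Ids \<Longrightarrow> 0 \<le> x \<Longrightarrow> x < p \<Longrightarrow> 0 \<le> y \<Longrightarrow> y < p \<Longrightarrow> \<bar>x - y\<bar> = \<mu> i \<Longrightarrow> link i x y"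
proof -
  assume *: "i \<in> Ids" "0 \<le> x" "x < p" "0 \<le> y" "y < p" "\<bar>x - y\<bar> = \<mu> i"
  then consider "y = x + \<mu> i" | "x = y + \<mu> i" by linarith
  then show ?thesis
  proof cases
    case 1
    then show ?thesis using link_shift[of i x] * by simp
  next
    case 2
    then show ?thesis using link_sym[OF link_shift[of i y]] * by simp
  qed
qed

lemma line: "0 \<le> a \<Longrightarrow> a \<le> b \<Longrightarrow> b < p \<Longrightarrow> route {a..b} {} a b"
proof -
  assume *: "0 \<le> a" "a \<le> b" "b < p"
  have "seg (\<lambda>x. x) p"
    unfolding seg_def
  proof (intro conjI allI ballI impI)
    show "link c x (x + \<mu> c)" if "c \<in> Ids" "0 \<le> x \<and> x + \<mu> c < p" for c x
      using link_shift that by blast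
  qed (auto simp: nodes intro: rail)
  from seg_line[OF this *] show ?thesis by simp
qed

text \<open>A route from \<open>\<alpha>\<close> to \<open>p - 1\<close> through \<open>{0..<e} \<union> {p - 1}\<close> is cut into two routes and a
  clean stretch \<open>{a..b}\<close> of the rail between them, traversed in either direction; the part
  \<open>{e..p - 2}\<close> of the rail is still to be traversed.\<close>

definition clean :: "int \<Rightarrow> int \<Rightarrow> int \<Rightarrow> 'i set \<Rightarrow> int \<Rightarrow> bool" where
  "clean \<alpha> a b X e \<longleftrightarrow> (\<exists>I Y s I' Y' t. route I Y \<alpha> s \<and> route I' Y' t (p - 1) \<and>
     I \<inter> I' = {} \<and> Y \<inter> Y' = {} \<and> Y \<union> Y' = X \<and> I \<union> I' = {0..<e} \<union> {p - 1} - {a..b} \<and>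
     (E (q s) (q a) \<and> E (q b) (q t) \<or> E (q s) (q b) \<and> E (q a) (q t)))"

lemma clean_route:
  assumes "clean \<alpha> a b X e" "0 \<le> a" "a \<le> b" "b < e" "e < p"
  shows "route ({0..<e} \<union> {p - 1}) X \<alpha> (p - 1)"
proof -
  obtain I Y s I' Y' t where *: "route I Y \<alpha> s" "route I' Y' t (p - 1)" "I \<inter> I' = {}" "Y \<inter> Y' = {}"
    "Y \<union> Y' = X" "I \<union> I' = {0..<e} \<union> {p - 1} - {a..b}"
    "E (q s) (q a) \<and> E (q b) (q t) \<or> E (q s) (q b) \<and> E (q a) (q t)"
    using assms(1) unfolding clean_def by blast
  have l: "route {a..b} {} a b" using assms by (intro line) auto
  have d: "I \<inter> {a..b} = {}" "I' \<inter> {a..b} = {}" using *(6) by auto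
  have "I \<union> {a..b} \<union> I' = {a..b} \<union> (I \<union> I')" by (simp only: Un_ac)
  also have "\<dots> = {0..<e} \<union> {p - 1}"
    unfolding *(6) by (rule Diff_partition) (use assms in auto)
  finally have K: "{0..<e} \<union> {p - 1} = I \<union> {a..b} \<union> I'" by (rule HOL.sym)
  obtain x y where xy: "route {a..b} {} x y" "E (q s) (q x)" "E (q y) (q t)"
    using *(7)
  proof
    assume "E (q s) (q a) \<and> E (q b) (q t)"
    then show thesis using that[OF l] by simp
  next
    assume "E (q s) (q b) \<and> E (q a) (q t)"
    then show thesis using that[OF route_sym[OF l]] by simp
  qed
  have "route (I \<union> {a..b}) Y \<alpha> y"
    by (rule route_join[OF *(1) xy(1,2)]) (use d in auto)
  then show ?thesis
    by (rule route_join[OF _ *(2) xy(3) _ *(4) K]) (use *(3,5) d in auto)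
qed

text \<open>The piece \<open>{e..e + (\<mu> i - \<mu> j + 1)}\<close> is moved into the edge from \<open>e - \<mu> j\<close> to \<open>e - \<mu> j + 1\<close>:
  the chord \<open>j\<close> joins \<open>e - \<mu> j\<close> to its first and \<open>i\<close> joins \<open>e - \<mu> j + 1\<close> to its last vertex.\<close>

lemma clean_pair:
  assumes "clean \<alpha> a b X e" "i \<in> Ids" "j \<in> Ids" "i \<noteq> j" "i \<notin> X" "j \<notin> X"
    "\<mu> j \<le> \<mu> i" "a \<le> e - \<mu> j" "e - \<mu> j + 2 \<le> b" "e + (\<mu> i - \<mu> j + 2) < p" "0 \<le> a" "b < e"
  shows "clean \<alpha> (e - \<mu> j + 2) b (insert i (insert j X)) (e + (\<mu> i - \<mu> j + 2))"
proof -
  define z where "z = e - \<mu> j"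
  define n where "n = \<mu> i - \<mu> j + 2"
  have n: "2 \<le> n" using assms(7) unfolding n_def by simp
  have z: "a \<le> z" "z + 2 \<le> b" "z + 2 < e" using assms unfolding z_def by auto
  have en: "e + n < p" using assms(10) unfolding n_def by simp
  obtain I Y s I' Y' t where *: "route I Y \<alpha> s" "route I' Y' t (p - 1)" "I \<inter> I' = {}" "Y \<inter> Y' = {}"
    "Y \<union> Y' = X" "I \<union> I' = {0..<e} \<union> {p - 1} - {a..b}"
    "E (q s) (q a) \<and> E (q b) (q t) \<or> E (q s) (q b) \<and> E (q a) (q t)"
    using assms(1) unfolding clean_def by blast
  have l1: "route {a..z} {} a z" by (rule line) (use assms z in auto)
  have l2: "route {e..e + n - 1} {} e (e + n - 1)" by (rule line) (use n en assms in auto)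
  have l3: "route {z + 1} {} (z + 1) (z + 1)"
    by (rule route_single) (use nodes assms z en n in auto)
  have k1: "link j z e" by (rule link_adj) (use assms z en n pos[of j] in \<open>auto simp: z_def\<close>)
  have k2: "link i (e + n - 1) (z + 1)"
    by (rule link_adj) (use assms z en n pos[of i] in \<open>auto simp: z_def n_def\<close>)
  have m1: "route ({a..z} \<union> {e..e + n - 1}) {j} a (e + n - 1)"
    by (rule route_link[OF l1 l2 k1 assms(3)]) (use z in auto)
  have m: "route ({a..z} \<union> {e..e + n - 1} \<union> {z + 1}) {i, j} a (z + 1)"
    by (rule route_link[OF m1 l3 k2 assms(2)]) (use z assms(4) in auto)
  let ?M = "{a..z} \<union> {e..e + n - 1} \<union> {z + 1}"
  have IJ: "I \<inter> ?M = {}" "I' \<inter> ?M = {}"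
  proof -
    have "?M \<inter> ({0..<e} \<union> {p - 1} - {a..b}) = {}" using z en by auto
    then show "I \<inter> ?M = {}" "I' \<inter> ?M = {}" using *(6) by blast+
  qed
  have YX: "Y \<inter> {i, j} = {}" "Y' \<inter> {i, j} = {}" using *(5) assms(5,6) by auto
  have cover: "?M \<union> ({0..<e} \<union> {p - 1} - {a..b}) = {0..<e + n} \<union> {p - 1} - {z + 2..b}"
    using z en n assms by auto
  have rail12: "E (q (z + 1)) (q (z + 2))" by (rule rail_adj) simp
  define M D D' where "M = ?M" and "D = {0..<e} \<union> {p - 1} - {a..b}"
    and "D' = {0..<e + n} \<union> {p - 1} - {z + 2..b}"
  note m = m[folded M_def] and IJ = IJ[folded M_def] and cover = cover[folded M_def D_def D'_def]
    and II = *(6)[folded D_def]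
  have "clean \<alpha> (z + 2) b (insert i (insert j X)) (e + n)"
    using *(7)
  proof
    assume st: "E (q s) (q a) \<and> E (q b) (q t)"
    have "route (I \<union> M) (Y \<union> {i, j}) \<alpha> (z + 1)"
      by (rule route_join[OF *(1) m]) (use st IJ YX in auto)
    moreover have "(I \<union> M) \<inter> I' = {}" "(Y \<union> {i, j}) \<inter> Y' = {}" "Y \<union> {i, j} \<union> Y' = insert i (insert j X)"
      "I \<union> M \<union> I' = D'"
      using IJ YX *(3-5) II cover by blast+
    ultimately show ?thesis
      using *(2) st rail12 unfolding clean_def D'_def[symmetric]
      by (intro exI[of _ "I \<union> M"] exI[of _ "Y \<union> {i, j}"] exI[of _ "z + 1"] exI[of _ I']
        exI[of _ Y'] exI[of _ t] conjI disjI1) simp_all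
  next
    \<comment> \<open>The stretch is traversed downwards here, so the altered part next to
      \<open>a\<close> comes after it and is put, reversed, in front of the second route.\<close>
    assume st: "E (q s) (q b) \<and> E (q a) (q t)"
    have "route (M \<union> I') ({i, j} \<union> Y') (z + 1) (p - 1)"
      by (rule route_join[OF route_sym[OF m] *(2)]) (use st IJ YX in auto)
    moreover have "I \<inter> (M \<union> I') = {}" "Y \<inter> ({i, j} \<union> Y') = {}" "Y \<union> ({i, j} \<union> Y') = insert i (insert j X)"
      "I \<union> (M \<union> I') = D'"
      using IJ YX *(3-5) II cover by blast+
    ultimately show ?thesis
      using *(1) st sym[OF rail12] unfolding clean_def D'_def[symmetric]
      by (intro exI[of _ I] exI[of _ Y] exI[of _ s] exI[of _ "M \<union> I'"]
        exI[of _ "{i, j} \<union> Y'"] exI[of _ "z + 1"] conjI disjI2) simp_all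
  qed
  then show ?thesis unfolding z_def n_def .
qed

definition flat :: "('i \<times> 'i) list \<Rightarrow> 'i list" where
  "flat ps = concat (map (\<lambda>(i, j). [i, j]) ps)"

lemma flat_simps [simp]: "flat [] = []" "flat ((i, j) # ps) = i # j # flat ps"
  by (simp_all add: flat_def)

text \<open>Longest pairs come first. Absorbing \<open>(i, j)\<close> raises \<open>e\<close> to
  \<open>e' = e + (\<mu> i - \<mu> j + 2)\<close>, and \<open>\<mu> j' \<le> \<mu> i\<close> for a
  later pair gives \<open>e - \<mu> j + 2 \<le> e' - \<mu> j'\<close>: the edge to be opened next
  lies in what is left of the clean stretch. Each pair contributes two chord lengths and two unit
  steps to the growth of \<open>e\<close>, hence the factor 4.\<close>

lemma clean_pairs:
  assumes "clean \<alpha> a b X e" "distinct (flat ps)" "set (flat ps) \<subseteq> Ids" "set (flat ps) \<inter> X = {}"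
    "sorted_wrt (\<lambda>(i, j) (i', j'). \<mu> j' \<le> \<mu> i) ps"
    "\<forall>(i, j)\<in>set ps. \<mu> j \<le> \<mu> i \<and> \<mu> i \<le> \<mu> j + G \<and> a \<le> e - \<mu> j \<and>
       e + int (length ps) * (G + 2) + 2 \<le> b + \<mu> j"
    "e + int (length ps) * (G + 2) < p" "0 \<le> a" "b < e" "a \<le> b" "0 \<le> G"
  shows "\<exists>a' e'. clean \<alpha> a' b (X \<union> set (flat ps)) e' \<and> a \<le> a' \<and> a' \<le> b \<and> e \<le> e' \<and>
    e' \<le> e + int (length ps) * (G + 2) \<and> small (4 * length ps) (e' - e)"
  using assms
proof (induction ps arbitrary: a X e)
  case Nil
  then show ?case using small_0 by (intro exI[of _ a] exI[of _ e]) auto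
next
  case (Cons ij ps)
  obtain i j where ij: "ij = (i, j)" by (cases ij)
  define e' where "e' = e + (\<mu> i - \<mu> j + 2)"
  define a' where "a' = e - \<mu> j + 2"
  define N where "N = int (length ps) * (G + 2)"
  have N0: "0 \<le> N" unfolding N_def using Cons.prems(11) by simp
  have mem: "i \<in> Ids" "j \<in> Ids" "i \<noteq> j" "i \<notin> X" "j \<notin> X" using Cons.prems ij by auto
  have N: "int (length (ij # ps)) * (G + 2) = N + G + 2" unfolding N_def by (simp add: algebra_simps)
  have b: "\<mu> j \<le> \<mu> i" "\<mu> i \<le> \<mu> j + G" "a \<le> e - \<mu> j" "e + N + G + 4 \<le> b + \<mu> j"
    using Cons.prems(6) ij N by auto
  have ee: "e \<le> e'" "e' \<le> e + G + 2" using b unfolding e'_def by auto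
  have 1: "clean \<alpha> a' b (insert i (insert j X)) e'"
    unfolding a'_def e'_def
    by (rule clean_pair[OF Cons.prems(1) mem]) (use b N N0 Cons.prems in auto)
  have "\<exists>a'' e''. clean \<alpha> a'' b (insert i (insert j X) \<union> set (flat ps)) e'' \<and> a' \<le> a'' \<and> a'' \<le> b \<and> e' \<le> e'' \<and>
    e'' \<le> e' + int (length ps) * (G + 2) \<and> small (4 * length ps) (e'' - e')"
  proof (rule Cons.IH[OF 1])
    show "\<forall>(i', j')\<in>set ps. \<mu> j' \<le> \<mu> i' \<and> \<mu> i' \<le> \<mu> j' + G \<and> a' \<le> e' - \<mu> j' \<and>
       e' + int (length ps) * (G + 2) + 2 \<le> b + \<mu> j'"
    proof clarify
      fix i' j' assume m: "(i', j') \<in> set ps"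
      then have "\<mu> j' \<le> \<mu> i" using Cons.prems(5) ij by auto
      moreover have "\<mu> j' \<le> \<mu> i' \<and> \<mu> i' \<le> \<mu> j' + G \<and> a \<le> e - \<mu> j' \<and> e + N + G + 4 \<le> b + \<mu> j'"
        using Cons.prems(6) m N by force
      ultimately show "\<mu> j' \<le> \<mu> i' \<and> \<mu> i' \<le> \<mu> j' + G \<and> a' \<le> e' - \<mu> j' \<and>
       e' + int (length ps) * (G + 2) + 2 \<le> b + \<mu> j'"
        using ee unfolding N_def[symmetric] by (auto simp: a'_def e'_def)
    qed
  qed (use Cons.prems ij b N N0 ee in \<open>auto simp: a'_def N_def[symmetric]\<close>)
  then obtain a'' e'' where *: "clean \<alpha> a'' b (insert i (insert j X) \<union> set (flat ps)) e''"
    "a' \<le> a''" "a'' \<le> b" "e' \<le> e''" "e'' \<le> e' + N" "small (4 * length ps) (e'' - e')"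
    unfolding N_def by blast
  have "small (1 + 1 + (1 + 1)) (\<mu> i - \<mu> j + (1 + 1))"
    by (intro small_add small_diff small_mu small_1 mem)
  then have "small 4 (e' - e)" by (simp add: e'_def eval_nat_numeral)
  from small_add[OF this *(6)] have "small (4 + 4 * length ps) (e'' - e)" by simp
  moreover have "insert i (insert j X) \<union> set (flat ps) = X \<union> set (flat (ij # ps))"
    using ij by auto
  ultimately show ?case
    using * ee b N by (intro exI[of _ a''] exI[of _ e'']) (auto simp: a'_def)
qed

text \<open>The list is read from the longest chord on. If the first two lengths differ by at most
  \<open>G\<close>, they form a pair; otherwise the first exceeds the second, and so every later
  one, by at least \<open>M\<close> and goes into \<open>os\<close>.\<close>

lemma greedy_pairs:
  assumes "sorted_wrt (\<lambda>i j. \<mu> j \<le> \<mu> i) xs" "\<forall>i\<in>set xs. \<forall>j\<in>set xs. \<mu> i \<le> \<mu> j + G \<or> \<mu> j + M \<le> \<mu> i"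
  shows "\<exists>ps os. mset (flat ps @ os) = mset xs \<and> sorted_wrt (\<lambda>(i, j) (i', j'). \<mu> j' \<le> \<mu> i) ps \<and>
    (\<forall>(i, j)\<in>set ps. \<mu> j \<le> \<mu> i \<and> \<mu> i \<le> \<mu> j + G) \<and> sorted_wrt (\<lambda>i j. \<mu> j + M \<le> \<mu> i) os"
  using assms
proof (induction xs rule: length_induct)
  case (1 xs)
  show ?case
  proof (cases xs)
    case Nil
    then show ?thesis by (intro exI[of _ "[]"]) simp
  next
    case x: (Cons x ys)
    show ?thesis
    proof (cases ys)
      case Nil
      then show ?thesis using x by (intro exI[of _ "[]"] exI[of _ "[x]"]) simp
    next
      case y: (Cons y r)
      have xy: "\<mu> y \<le> \<mu> x" "\<forall>z\<in>set r. \<mu> z \<le> \<mu> y" using 1(2) x y by auto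
      show ?thesis
      proof (cases "\<mu> x \<le> \<mu> y + G")
        case True
        have "\<exists>ps os. mset (flat ps @ os) = mset r \<and> sorted_wrt (\<lambda>(i, j) (i', j'). \<mu> j' \<le> \<mu> i) ps \<and>
          (\<forall>(i, j)\<in>set ps. \<mu> j \<le> \<mu> i \<and> \<mu> i \<le> \<mu> j + G) \<and> sorted_wrt (\<lambda>i j. \<mu> j + M \<le> \<mu> i) os"
          by (rule 1(1)[rule_format]) (use 1(2,3) x y in auto)
        then obtain ps os where *: "mset (flat ps @ os) = mset r"
          "sorted_wrt (\<lambda>(i, j) (i', j'). \<mu> j' \<le> \<mu> i) ps"
          "\<forall>(i, j)\<in>set ps. \<mu> j \<le> \<mu> i \<and> \<mu> i \<le> \<mu> j + G" "sorted_wrt (\<lambda>i j. \<mu> j + M \<le> \<mu> i) os"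
          by blast
        have "set (flat ps) \<subseteq> set r" using mset_eq_setD[OF *(1)] by auto
        then have "\<forall>(i', j')\<in>set ps. \<mu> j' \<le> \<mu> x"
          using xy by (fastforce simp: flat_def)
        then show ?thesis using * True xy x y
          by (intro exI[of _ "(x, y) # ps"] exI[of _ os]) auto
      next
        case False
        have "\<exists>ps os. mset (flat ps @ os) = mset ys \<and> sorted_wrt (\<lambda>(i, j) (i', j'). \<mu> j' \<le> \<mu> i) ps \<and>
          (\<forall>(i, j)\<in>set ps. \<mu> j \<le> \<mu> i \<and> \<mu> i \<le> \<mu> j + G) \<and> sorted_wrt (\<lambda>i j. \<mu> j + M \<le> \<mu> i) os"
          by (rule 1(1)[rule_format]) (use 1(2,3) x y in auto)
        then obtain ps os where *: "mset (flat ps @ os) = mset ys"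
          "sorted_wrt (\<lambda>(i, j) (i', j'). \<mu> j' \<le> \<mu> i) ps"
          "\<forall>(i, j)\<in>set ps. \<mu> j \<le> \<mu> i \<and> \<mu> i \<le> \<mu> j + G" "sorted_wrt (\<lambda>i j. \<mu> j + M \<le> \<mu> i) os"
          by blast
        have os: "set os \<subseteq> set ys" using mset_eq_setD[OF *(1)] by auto
        have "\<mu> y + M \<le> \<mu> x" using 1(3) x y False by auto
        then have "\<forall>z\<in>set os. \<mu> z + M \<le> \<mu> x" using os xy y by fastforce
        then show ?thesis using * x
          by (intro exI[of _ ps] exI[of _ "x # os"]) auto
      qed
    qed
  qed
qed

section \<open>Absorbing all chords of one rail\<close>

lemma sum_le_length: "\<forall>i\<in>set xs. \<mu> i \<le> G \<Longrightarrow> (\<Sum>i\<leftarrow>xs. \<mu> i) \<le> int (length xs) * G"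
  by (induction xs) (auto simp: algebra_simps)

text \<open>The underlying path is \<open>e - 1, e - 2, ..., 1, 0, p - 1\<close>. Its start is one
  step away from \<open>e\<close>, which keeps the difference \<open>e - \<alpha>\<close>
  small.\<close>

lemma clean_start:
  assumes "3 \<le> e" "e < p - 1"
  shows "clean (e - 1) 1 (e - 2) {} e"
proof -
  have 1: "route {e - 1} {} (e - 1) (e - 1)" by (rule route_single) (use nodes assms in auto)
  have 2: "route {0} {} 0 0" by (rule route_single) (use nodes assms in auto)
  have 3: "route {p - 1, 0} {} 0 (p - 1)"
    by (rule route_snoc[OF 2 wrap]) (use nodes assms in auto)
  have 4: "E (q (e - 1)) (q (e - 2))" "E (q 1) (q 0)" by (auto intro: rail_adj)
  have 5: "{e - 1} \<union> {p - 1, 0} = {0..<e} \<union> {p - 1} - {1..e - 2}" "{e - 1} \<inter> {p - 1, 0} = {}"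
    using assms by auto
  show ?thesis
    unfolding clean_def using 1 3 4 5
    by (intro exI[of _ "{e - 1}"] exI[of _ "{}"] exI[of _ "e - 1"] exI[of _ "{p - 1, 0}"]
      exI[of _ "{}"] exI[of _ 0] conjI disjI2) simp_all
qed

text \<open>The underlying path is \<open>0, 1, ..., e - 1, p - 1\<close>, where the last step is
  the chord \<open>i\<close>. The start differs from \<open>e\<close> by \<open>p - \<mu> i\<close>,
  which is small because \<open>p\<close> steps make no displacement.\<close>

lemma clean_start_chord:
  assumes "i \<in> Ids" "e = p - \<mu> i" "3 \<le> e" "2 \<le> \<mu> i"
  shows "clean 0 1 (e - 2) {i} e"
proof -
  have 1: "route {0} {} 0 0" by (rule route_single) (use nodes assms in auto)
  have 2: "route {e - 1} {} (e - 1) (e - 1)" by (rule route_single) (use nodes assms in auto)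
  have 3: "route {p - 1, e - 1} {i} (e - 1) (p - 1)"
    by (rule route_snoc_link[OF 2 link_adj]) (use nodes assms in auto)
  have 4: "E (q 0) (q 1)" "E (q (e - 2)) (q (e - 1))" by (auto intro: rail_adj)
  have 5: "{0} \<union> {p - 1, e - 1} = {0..<e} \<union> {p - 1} - {1..e - 2}" "{0} \<inter> {p - 1, e - 1} = {}"
    using assms by auto
  show ?thesis
    unfolding clean_def using 1 3 4 5
    by (intro exI[of _ "{0}"] exI[of _ "{}"] exI[of _ 0] exI[of _ "{p - 1, e - 1}"]
      exI[of _ "{i}"] exI[of _ "e - 1"] conjI disjI1) simp_all
qed

text \<open>The remaining stretch \<open>{e..p - 2}\<close> is entered from \<open>p - 1\<close> at
  its upper end, which is the situation of \<open>seg_spiral\<close> with index \<open>0\<close>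
  placed at \<open>e\<close>.\<close>

lemma clean_finish:
  assumes "clean \<alpha> a b X e" "0 \<le> a" "a \<le> b" "b < e" "e < p - 1" "distinct (os @ xs)"
    "set (os @ xs) \<subseteq> Ids" "set (os @ xs) \<inter> X = {}"
    "sorted_wrt (\<lambda>i j. \<mu> j + 2 \<le> \<mu> i) os" "\<forall>i\<in>set os. \<mu> i < p - 1 - e"
    "2 + (\<Sum>i\<leftarrow>xs. \<mu> i) < p - 1 - e" "\<forall>i\<in>set os. 3 + (\<Sum>i\<leftarrow>xs. \<mu> i) < \<mu> i"
  shows "\<exists>t. small (2 * length (os @ xs)) t \<and> route {0..<p} (X \<union> set (os @ xs)) \<alpha> (e + t)"
proof -
  let ?f = "\<lambda>i. e + i" and ?L = "p - 1 - e"
  have seg: "seg ?f ?L"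
    unfolding seg_def
  proof (intro conjI allI ballI impI)
    show "inj_on ?f {0..<?L}" by simp
    show "?f ` {0..<?L} \<subseteq> J" using nodes assms(2-5) by auto
    show "E (q (e + i)) (q (e + (i + 1)))" for i by (rule rail_adj) simp
    show "link c (e + x) (e + (x + \<mu> c))" if "c \<in> Ids" "0 \<le> x \<and> x + \<mu> c < ?L" for c x
      by (rule link_adj) (use that pos[of c] assms(2-5) in auto)
  qed
  obtain t where t: "small (2 * length (os @ xs)) t"
    "route (?f ` {0..?L - 1}) (set (os @ xs)) (e + (?L - 1)) (e + t)"
    using seg_spiral[OF seg assms(6,7,9-12)] by blast
  have im: "?f ` {0..?L - 1} = {e..p - 2}"
    using image_add_atLeastAtMost[of e 0 "?L - 1"] by (simp add: algebra_simps)
  have 1: "route {e..p - 2} (set (os @ xs)) (p - 2) (e + t)"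
    using t(2) unfolding im by (simp add: algebra_simps)
  have 2: "route ({0..<e} \<union> {p - 1}) X \<alpha> (p - 1)"
    by (rule clean_route[OF assms(1)]) (use assms in auto)
  have 3: "E (q (p - 1)) (q (p - 2))" by (rule rail_adj) simp
  have 4: "({0..<e} \<union> {p - 1}) \<inter> {e..p - 2} = {}" "{0..<p} = {0..<e} \<union> {p - 1} \<union> {e..p - 2}"
    using assms(2-5) by auto
  have "route {0..<p} (X \<union> set (os @ xs)) \<alpha> (e + t)"
    by (rule route_join[OF 2 1 3 4(1) _ 4(2)]) (use assms(8) in auto)
  with t(1) show ?thesis by blast
qed

theorem absorb:
  assumes ids: "distinct (ss @ ls)" "set (ss @ ls) = Ids"
    and ss: "\<forall>i\<in>set ss. \<mu> i \<le> G"
    and ls: "\<forall>i\<in>set ls. M \<le> \<mu> i \<and> 2 * \<mu> i < p"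
      "\<forall>i\<in>set ls. \<forall>j\<in>set ls. \<mu> i \<le> \<mu> j + G \<or> \<mu> j + M \<le> \<mu> i"
    and M: "int (length (ss @ ls)) * (2 * G + 2) + 10 \<le> M" "2 * M < p" "0 \<le> G"
  shows "\<exists>\<alpha> y. route {0..<p} Ids \<alpha> y \<and> small (4 * length (ss @ ls) + 2) (y - \<alpha>)"
proof -
  define xs where "xs = sort_key (\<lambda>i. - \<mu> i) ls"
  have "sorted (map (\<lambda>i. - \<mu> i) xs)" unfolding xs_def by (rule sorted_sort_key)
  then have "sorted_wrt (\<lambda>i j. \<mu> j \<le> \<mu> i) xs" by (simp add: sorted_wrt_map)
  from greedy_pairs[OF this, of G M] obtain ps os where g: "mset (flat ps @ os) = mset ls"
    "sorted_wrt (\<lambda>(i, j) (i', j'). \<mu> j' \<le> \<mu> i) ps" "\<forall>(i, j)\<in>set ps. \<mu> j \<le> \<mu> i \<and> \<mu> i \<le> \<mu> j + G"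
    "sorted_wrt (\<lambda>i j. \<mu> j + M \<le> \<mu> i) os"
    using ls(2) unfolding xs_def by auto
  have dist: "distinct (flat ps @ os)"
    using mset_eq_imp_distinct_iff[OF g(1)] ids(1) by simp
  have set: "set (flat ps) \<union> set os = set ls"
    using mset_eq_setD[OF g(1)] by simp
  have "length (flat ps) = 2 * length ps" for ps :: "('i \<times> 'i) list"
    by (induction ps) auto
  then have len: "2 * length ps + length os = length ls"
    using mset_eq_length[OF g(1)] by simp
  define n where "n = int (length (ss @ ls))"
  \<comment> \<open>The pairs add at most \<open>N\<close> to \<open>e\<close>. Since
    \<open>p - e\<close> will be at least \<open>M\<close>, and \<open>M\<close> exceeds
    \<open>N\<close> plus the total length of the bounded chords, there is room for both.\<close>
  define N where "N = int (length ps) * (G + 2)"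
  have "2 * int (length ps) \<le> n" using len unfolding n_def by simp
  have Nn: "N \<le> n * (G + 2)"
    unfolding N_def using len M(3) by (intro mult_right_mono) (auto simp: n_def)
  have "(\<Sum>i\<leftarrow>ss. \<mu> i) \<le> int (length ss) * G" by (rule sum_le_length[OF ss])
  also have "\<dots> \<le> n * G" unfolding n_def using M(3) by (intro mult_right_mono) auto
  finally have "N + (\<Sum>i\<leftarrow>ss. \<mu> i) \<le> n * (2 * G + 2)" using Nn by (simp add: algebra_simps)
  moreover have s0: "0 \<le> (\<Sum>i\<leftarrow>ss. \<mu> i)"
    by (rule sum_list_nonneg) (use pos ids(2) in force)
  moreover have N0: "0 \<le> N" unfolding N_def using M(3) by simp
  ultimately have NM: "N + (\<Sum>i\<leftarrow>ss. \<mu> i) + 10 \<le> M" "N + 10 \<le> M"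
    using M(1) unfolding n_def by auto
  \<comment> \<open>Without unpaired long chords the path begins at \<open>p - M - 1\<close>.
    Otherwise the longest of them, \<open>o1\<close>, replaces the wrap-around edge and
    \<open>e = p - \<mu> o1\<close>; the others are shorter by at least \<open>M\<close>, so they
    fit into the stretch that remains after the pairs. In both cases \<open>p < 2 * e\<close>, which
    keeps the targets \<open>e - \<mu> j\<close> of the pairs positive.\<close>
  obtain \<alpha> e X os' where st: "clean \<alpha> 1 (e - 2) X e" "set os' \<union> X = set os" "distinct os'"
    "set os' \<inter> X = {}" "small 2 (e - \<alpha>)" "M \<le> p - e" "p < 2 * e" "\<forall>i\<in>set os'. \<mu> i + M \<le> p - e"
    "sorted_wrt (\<lambda>i j. \<mu> j + M \<le> \<mu> i) os'" "length os' \<le> length os"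
  proof (cases os)
    case Nil
    have "small 2 1" by (rule small_mono[OF small_1]) simp
    moreover have "clean (p - M - 1) 1 (p - M - 2) {} (p - M)"
      by (rule clean_start) (use NM N0 M in auto)
    ultimately show thesis
      using Nil M(2) by (intro that[of "p - M - 1" "p - M" "{}" "[]"]) auto
  next
    case (Cons o1 r)
    have o1: "o1 \<in> Ids" "M \<le> \<mu> o1" "2 * \<mu> o1 < p" using Cons set ids(2) ls(1) by auto
    have "small (0 + 1) (p - \<mu> o1)" by (intro small_diff small_p small_mu o1)
    then have 1: "small 2 (p - \<mu> o1)" by (rule small_mono) simp
    have 2: "clean 0 1 (p - \<mu> o1 - 2) {o1} (p - \<mu> o1)"
      by (rule clean_start_chord[OF o1(1) refl]) (use o1 NM N0 M in auto)
    show thesis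
      using 1 2 o1 Cons g(4) dist by (intro that[of 0 "p - \<mu> o1" "{o1}" r]) auto
  qed
  have X: "X \<subseteq> set os" using st(2) by blast
  have 3: "\<exists>a' e'. clean \<alpha> a' (e - 2) (X \<union> set (flat ps)) e' \<and> 1 \<le> a' \<and> a' \<le> e - 2 \<and> e \<le> e' \<and>
    e' \<le> e + int (length ps) * (G + 2) \<and> small (4 * length ps) (e' - e)"
  proof (rule clean_pairs[OF st(1)])
    show "\<forall>(i, j)\<in>set ps. \<mu> j \<le> \<mu> i \<and> \<mu> i \<le> \<mu> j + G \<and> 1 \<le> e - \<mu> j \<and>
       e + int (length ps) * (G + 2) + 2 \<le> e - 2 + \<mu> j"
    proof clarify
      fix i j assume ij: "(i, j) \<in> set ps"
      then have "j \<in> set (flat ps)" unfolding flat_def by force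
      then have "M \<le> \<mu> j" "2 * \<mu> j < p" using set ls(1) by auto
      then show "\<mu> j \<le> \<mu> i \<and> \<mu> i \<le> \<mu> j + G \<and> 1 \<le> e - \<mu> j \<and>
       e + int (length ps) * (G + 2) + 2 \<le> e - 2 + \<mu> j"
        using g(3) ij NM st(7) unfolding N_def[symmetric] by auto
    qed
    show "e + int (length ps) * (G + 2) < p"
      using st(6) NM N0 unfolding N_def[symmetric] by linarith
  qed (use dist X set ids g NM N0 M st in auto)
  then obtain a' e' where e': "clean \<alpha> a' (e - 2) (X \<union> set (flat ps)) e'" "1 \<le> a'" "a' \<le> e - 2"
    "e \<le> e'" "e' \<le> e + N" "small (4 * length ps) (e' - e)"
    unfolding N_def by blast
  have os': "\<forall>i\<in>set os'. M \<le> \<mu> i" using st(2) set ls(1) by auto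
  have "\<exists>t. small (2 * length (os' @ ss)) t \<and>
      route {0..<p} (X \<union> set (flat ps) \<union> set (os' @ ss)) \<alpha> (e' + t)"
  proof (rule clean_finish[OF e'(1)])
    show "sorted_wrt (\<lambda>i j. \<mu> j + 2 \<le> \<mu> i) os'"
      using st(9) by (rule sorted_wrt_mono_rel[rotated]) (use NM N0 in auto)
    show "distinct (os' @ ss)" "set (os' @ ss) \<subseteq> Ids"
      "set (os' @ ss) \<inter> (X \<union> set (flat ps)) = {}"
      using st(2-4) set ids dist by auto
    show "\<forall>i\<in>set os'. \<mu> i < p - 1 - e'" using st(8) e'(5) NM N0 by fastforce
    show "2 + (\<Sum>i\<leftarrow>ss. \<mu> i) < p - 1 - e'" "e' < p - 1"
      using st(6) e'(5) NM N0 s0 by linarith+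
    show "\<forall>i\<in>set os'. 3 + (\<Sum>i\<leftarrow>ss. \<mu> i) < \<mu> i" using os' NM N0 by fastforce
  qed (use e' in auto)
  then obtain t where t: "small (2 * length (os' @ ss)) t"
    "route {0..<p} (X \<union> set (flat ps) \<union> set (os' @ ss)) \<alpha> (e' + t)" by blast
  have "X \<union> set (flat ps) \<union> set (os' @ ss) = Ids" using st(2) set ids(2) by auto
  moreover have "small (4 * length ps + 2 + 2 * length (os' @ ss)) (e' - e + (e - \<alpha>) + t)"
    by (intro small_add e' st t)
  then have "small (4 * length (ss @ ls) + 2) (e' - e + (e - \<alpha>) + t)"
    by (rule small_mono) (use len st(10) in simp)
  ultimately show ?thesis
    using t(2) by (intro exI[of _ \<alpha>] exI[of _ "e' + t"]) (simp add: algebra_simps)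
qed

end

section \<open>Lifts over a cyclic group of prime order\<close>

text \<open>A displacement \<open>d\<close> or \<open>- d\<close> is made by \<open>m\<close> steps
  of size \<open>k\<close>, and the choice of the sign \<open>s\<close> gives
  \<open>2 * m < p\<close>. The winding number \<open>r\<close> records how often \<open>p\<close>
  is subtracted; chord lengths are compared through it later.\<close>

lemma centered_quotient:
  fixes k p d :: int
  assumes "prime p" "odd p" "0 < k" "k < p" "0 < d" "d < p"
  shows "\<exists>m s r. 1 \<le> m \<and> 2 * m < p \<and> \<bar>s\<bar> = 1 \<and> 0 \<le> r \<and> k * m = s * d + r * p"
proof -
  have "coprime k p"
    using assms by (meson coprime_commute prime_imp_coprime zdvd_not_zless)
  then have "gcd k p = 1" by simp
  then obtain x z where xz: "x * k + z * p = 1" using bezout_int[of k p] by auto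
  define y where "y = (x * d) mod p"
  have p: "0 < p" using assms by simp
  have "k * (x * d) - d = p * (- z * d)"
  proof -
    have "k * (x * d) - d = (x * k + z * p - 1) * d - p * (z * d)" by (simp add: algebra_simps)
    then show ?thesis using xz by simp
  qed
  then have "p dvd k * (x * d) - d" by simp
  moreover have "p dvd k * (x * d) - k * y"
    unfolding y_def by (metis mod_eq_dvd_iff mod_mult_right_eq)
  ultimately have ky: "p dvd k * y - d"
    by (metis mod_eq_dvd_iff)
  have y: "0 \<le> y" "y < p" unfolding y_def using p by auto
  have "y \<noteq> 0"
  proof
    assume "y = 0"
    with ky have "p dvd d" by simp
    then show False using assms zdvd_not_zless by blast
  qed
  then have y1: "1 \<le> y" using y by simp
  have *: "\<exists>m s r. 1 \<le> m \<and> 2 * m < p \<and> \<bar>s\<bar> = 1 \<and> 0 \<le> r \<and> k * m = s * d + r * p"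
    if m: "1 \<le> m" "2 * m < p" "\<bar>s\<bar> = 1" "p dvd k * m - s * d" for m s
  proof -
    obtain r where r: "k * m - s * d = p * r" using m(4) by (rule dvdE)
    have "\<bar>s * d\<bar> = d" using m(3) assms by (simp add: abs_mult)
    then have "s * d < p" using assms by linarith
    moreover have "0 < k * m" using m(1) assms by simp
    ultimately have "- p < p * r" using r by linarith
    then have "0 < p * (r + 1)" by (simp add: algebra_simps)
    then have "0 \<le> r" using p by (simp add: zero_less_mult_iff)
    then show ?thesis using m r by (intro exI[of _ m] exI[of _ s] exI[of _ r]) (simp add: algebra_simps)
  qed
  show ?thesis
  proof (cases "2 * y < p")
    case True
    with y1 ky show ?thesis by (intro *[of y 1]) auto
  next
    case False
    then have "2 * (p - y) < p" using assms(2) by presburger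
    moreover have "p dvd k * (p - y) - - 1 * d"
    proof -
      have "k * (p - y) - - 1 * d = p * k - (k * y - d)" by (simp add: algebra_simps)
      then show ?thesis using dvd_diff[OF dvd_triv_left ky, of k] by (simp only:)
    qed
    ultimately show ?thesis using y by (intro *[of "p - y" "- 1"]) auto
  qed
qed

locale cyclic_lift =
  fixes V :: "'v set" and E :: "'v \<times> int \<Rightarrow> 'v \<times> int \<Rightarrow> bool" and p :: int
    and k :: "'v \<Rightarrow> int" and K :: int
  assumes finite_V: "finite V"
    and prime_p: "prime p" and odd_p: "odd p"
    and sym: "E s t \<Longrightarrow> E t s"
    and shift: "E (x, a) (y, b) \<Longrightarrow> E (x, (a + c) mod p) (y, (b + c) mod p)"
    and loop: "w \<in> V \<Longrightarrow> E (w, a mod p) (w, (a + k w) mod p)"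
    and k_pos: "w \<in> V \<Longrightarrow> 0 < k w" and k_le: "w \<in> V \<Longrightarrow> k w \<le> K"
begin

lemma p_pos: "0 < p" "2 < p"
  using prime_p odd_p prime_ge_2_int[of p] by (auto simp: le_less)

section \<open>Systems of contracted chords\<close>

definition nb :: "'v \<Rightarrow> 'v \<Rightarrow> bool" where
  "nb x y \<longleftrightarrow> (\<exists>h. \<forall>a. E (x, a mod p) (y, (a + h) mod p))"

definition fibres :: "'v set \<Rightarrow> ('v \<times> int) set" where
  "fibres A = A \<times> {0..<p}"

text \<open>The state in which the fibres outside \<open>R\<close> have been contracted: a triple
  \<open>(r, A, d)\<close> is a chord of length \<open>d\<close> at \<open>r\<close> whose interior
  consists of the fibres over \<open>A\<close>, available at every position \<open>c\<close>. The
  sets \<open>A\<close> divide \<open>V - R\<close> among the chords.\<close>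

definition chord_system :: "'v set \<Rightarrow> ('v \<times> 'v set \<times> int) set \<Rightarrow> int \<Rightarrow> bool" where
  "chord_system R C B \<longleftrightarrow> finite C \<and> (\<forall>(r, A, d)\<in>C. r \<in> R \<and> 0 < d \<and> d \<le> B \<and>
       (\<forall>c. chord E (fibres A) (r, c mod p) (r, (c + d) mod p))) \<and>
     (\<forall>i\<in>C. \<forall>j\<in>C. i \<noteq> j \<longrightarrow> fst (snd i) \<inter> fst (snd j) = {}) \<and>
     (\<Union>(r, A, d)\<in>C. A) = V - R"

text \<open>The sets \<open>A\<close> are disjoint, and nonempty because a Hamiltonian path has
  ends, so the chords have distinct representatives in \<open>V\<close>.\<close>

lemma chord_system_card: "chord_system R C B \<Longrightarrow> card C \<le> card V"
proof -
  assume C: "chord_system R C B"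
  have ne: "fst (snd i) \<noteq> {}" if "i \<in> C" for i
  proof -
    have "\<forall>c. chord E (fibres (fst (snd i))) (fst i, c mod p) (fst i, (c + snd (snd i)) mod p)"
      using C that unfolding chord_system_def by (cases i) fastforce
    then obtain a b where "ham_path E (fibres (fst (snd i))) a b" unfolding chord_def by blast
    from ham_path_ends[OF this] show ?thesis unfolding fibres_def by auto
  qed
  define f where "f i = (SOME x. x \<in> fst (snd i))" for i :: "'v \<times> 'v set \<times> int"
  have f: "f i \<in> fst (snd i)" if "i \<in> C" for i
    unfolding f_def using ne[OF that] by (meson ex_in_conv someI)
  have "inj_on f C"
    using C f unfolding chord_system_def inj_on_def by (metis disjoint_iff)
  moreover have "f ` C \<subseteq> V"
    using C f unfolding chord_system_def by fastforce
  ultimately show ?thesis using finite_V by (metis card_inj_on_le)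
qed

section \<open>Contracting one fibre\<close>

lemma mod_inj: "w \<in> V \<Longrightarrow> k w < p \<Longrightarrow> (k w * x) mod p = (k w * y) mod p \<longleftrightarrow> p dvd x - y"
proof -
  assume w: "w \<in> V" "k w < p"
  have "\<not> p dvd k w" using w k_pos zdvd_not_zless by blast
  then have "p dvd k w * (x - y) \<longleftrightarrow> p dvd x - y"
    using prime_p by (simp add: prime_dvd_mult_iff)
  then show ?thesis by (simp add: mod_eq_dvd_iff algebra_simps)
qed

lemma ham_path_shift:
  assumes "ham_path E (fibres A) (x, a) (y, b)"
  shows "ham_path E (fibres A) (x, (a + c) mod p) (y, (b + c) mod p)"
proof -
  let ?f = "\<lambda>(x, a). (x, (a + c) mod p)"
  have inj: "inj_on ?f (fibres A)"
  proof (rule inj_onI; clarsimp simp: fibres_def)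
    fix a b :: int assume ab: "0 \<le> a" "a < p" "0 \<le> b" "b < p" "(a + c) mod p = (b + c) mod p"
    then have "p dvd a - b" by (simp add: mod_eq_dvd_iff)
    then show "a = b" using ab
      by (metis mod_eq_dvd_iff mod_pos_pos_trivial)
  qed
  have "?f ` fibres A = fibres A"
  proof
    show "?f ` fibres A \<subseteq> fibres A" using p_pos by (auto simp: fibres_def)
    show "fibres A \<subseteq> ?f ` fibres A"
    proof clarify
      fix x a assume "(x, a) \<in> fibres A"
      then have "(x, a) = ?f (x, (a - c) mod p)" "(x, (a - c) mod p) \<in> fibres A"
        using p_pos by (auto simp: fibres_def mod_simps)
      then show "(x, a) \<in> ?f ` fibres A" by blast
    qed
  qed
  moreover have "ham_path E (?f ` fibres A) (?f (x, a)) (?f (y, b))"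
    by (rule ham_path_map[OF assms inj]) (use shift in auto)
  ultimately show ?thesis by simp
qed

text \<open>In \<open>k w * \<mu> i = s i * snd (snd i) + r i * p\<close> the first summand is
  bounded by \<open>B\<close>, so the winding number \<open>r i\<close> governs the length: value
  zero gives \<open>\<mu> i \<le> 2 * B\<close>, equal values give lengths differing by at most
  \<open>2 * B\<close>, and distinct values give lengths at least \<open>(p - 2 * B) / k w\<close>
  apart. This is what \<open>absorb\<close> asks for.\<close>

lemma absorb_fibre:
  assumes C: "chord_system (insert w R) C B" and w: "w \<in> V" "w \<notin> R"
    and B: "K \<le> B" "2 * B + 3 * K * (int (card V) * (4 * B + 2) + 11) \<le> p"
  shows "\<exists>D. 0 < D \<and> D \<le> (4 * int (card V) + 2) * B \<and>
    (\<forall>c. ham_path E (fibres (insert w (\<Union>(r, A, d)\<in>{i \<in> C. fst i = w}. A)))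
       (w, c mod p) (w, (c + D) mod p))"
proof -
  define n where "n = int (card V)"
  define Cw where "Cw = {i \<in> C. fst i = w}"
  define S where "S i = fibres (fst (snd i))" for i :: "'v \<times> 'v set \<times> int"
  define q where "q x = (w, (k w * x) mod p)" for x
  have k: "0 < k w" "k w \<le> K" "k w \<le> B" using k_pos k_le w B by fastforce+
  have n1: "1 \<le> n" unfolding n_def using w finite_V by (metis card_gt_0_iff empty_iff int_one_le_iff_zero_less of_nat_0_less_iff)
  have K1: "1 \<le> K" using k by simp
  have B1: "1 \<le> B" using K1 B by simp
  define X where "X = n * (4 * B + 2) + 11"
  have nB: "0 \<le> n * (4 * B + 2)" using n1 B1 by simp
  then have X: "11 \<le> X" unfolding X_def by simp
  have BX: "2 * B + 3 * K * X \<le> p" using B(2) unfolding X_def n_def .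
  have "1 * X \<le> 3 * K * X"
    using K1 X by (intro mult_right_mono) auto
  then have pB: "2 * B + 11 \<le> p" using BX X by linarith
  then have kp: "k w < p" using k B1 by linarith
  have finC: "finite Cw" using C unfolding Cw_def chord_system_def by auto
  have cardC: "int (card Cw) \<le> n"
  proof -
    have "card Cw \<le> card C" unfolding Cw_def
      using C by (intro card_mono) (auto simp: chord_system_def)
    then show ?thesis using chord_system_card[OF C] unfolding n_def by simp
  qed
  have Cw: "0 < snd (snd i)" "snd (snd i) \<le> B" "fst (snd i) \<subseteq> V - insert w R"
    "chord E (S i) (w, c mod p) (w, (c + snd (snd i)) mod p)" if mem: "i \<in> Cw" for i c
  proof -
    obtain A d where i: "i = (w, A, d)" "(w, A, d) \<in> C"
      using mem unfolding Cw_def by (cases i) auto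
    have "0 < d \<and> d \<le> B \<and> (\<forall>c. chord E (fibres A) (w, c mod p) (w, (c + d) mod p))"
      using bspec[OF conjunct1[OF conjunct2[OF C[unfolded chord_system_def]]] i(2)] by simp
    moreover have "A \<subseteq> (\<Union>(r, A, d)\<in>C. A)" using i(2) by force
    moreover have "(\<Union>(r, A, d)\<in>C. A) = V - insert w R"
      using C unfolding chord_system_def by blast
    ultimately show "0 < snd (snd i)" "snd (snd i) \<le> B" "fst (snd i) \<subseteq> V - insert w R"
      "chord E (S i) (w, c mod p) (w, (c + snd (snd i)) mod p)"
      unfolding i(1) S_def by auto
  qed
  have "\<forall>i\<in>Cw. \<exists>m s r. 1 \<le> m \<and> 2 * m < p \<and> \<bar>s\<bar> = 1 \<and> 0 \<le> r \<and> k w * m = s * snd (snd i) + r * p"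
    using centered_quotient[OF prime_p odd_p k(1) kp] Cw(1,2) pB B1 by force
  then obtain \<mu> s r where \<mu>: "\<And>i. i \<in> Cw \<Longrightarrow> 1 \<le> \<mu> i \<and> 2 * \<mu> i < p \<and> \<bar>s i\<bar> = (1::int) \<and> 0 \<le> (r i :: int) \<and>
      k w * \<mu> i = s i * snd (snd i) + r i * p"
    by metis
  have dis: "\<forall>i\<in>C. \<forall>j\<in>C. i \<noteq> j \<longrightarrow> fst (snd i) \<inter> fst (snd j) = {}"
    using C unfolding chord_system_def by (elim conjE)
  have sd: "\<bar>s i * snd (snd i)\<bar> \<le> B" if "i \<in> Cw" for i
    using \<mu>[OF that] Cw(1,2)[OF that] by (simp add: abs_mult)
  have qeq: "q x = q y \<longleftrightarrow> p dvd x - y" for x y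
    unfolding q_def using mod_inj[OF w(1) kp] by simp
  interpret rails E q "{0..<p}" S Cw \<mu> p "k w" B
  proof
    show "E x y \<Longrightarrow> E y x" for x y by (rule sym)
    show "inj_on q {0..<p}"
    proof (rule inj_onI)
      fix x y assume xy: "x \<in> {0..<p}" "y \<in> {0..<p}" "q x = q y"
      then have "p dvd x - y" by (simp add: qeq)
      then have "x mod p = y mod p" by (simp only: mod_eq_dvd_iff)
      then show "x = y" using xy by simp
    qed
    show "S i \<inter> q ` {0..<p} = {}" if "i \<in> Cw" for i
      using Cw(3)[OF that] unfolding S_def q_def fibres_def by auto
    show "S i \<inter> S j = {}" if "i \<in> Cw" "j \<in> Cw" "i \<noteq> j" for i j
    proof -
      have "fst (snd i) \<inter> fst (snd j) = {}"
        using dis that unfolding Cw_def by blast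
      then show ?thesis unfolding S_def fibres_def by auto
    qed
    show rail: "E (q x) (q (x + 1))" for x
      using loop[OF w(1), of "k w * x"] unfolding q_def by (simp add: algebra_simps)
    have "q (p - 1 + 1) = q 0" by (simp add: qeq)
    then show "E (q 0) (q (p - 1))" using sym[OF rail[of "p - 1"]] by simp
    show "chord E (S i) (q x) (q (x + \<mu> i))" if i: "i \<in> Cw" for i x
    proof -
      from \<mu>[OF i] have "s i = 1 \<or> s i = - 1" by auto
      then show ?thesis
      proof
        assume "s i = 1"
        then have "k w * (x + \<mu> i) - (k w * x + snd (snd i)) = p * r i"
          using \<mu>[OF i] by (simp add: distrib_left mult.commute)
        then have "(k w * (x + \<mu> i)) mod p = (k w * x + snd (snd i)) mod p"
          by (simp only: mod_eq_dvd_iff dvd_triv_left)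
        then show ?thesis using Cw(4)[OF i, of "k w * x"] unfolding q_def by simp
      next
        assume "s i = - 1"
        then have "k w * (x + \<mu> i) + snd (snd i) - k w * x = p * r i"
          using \<mu>[OF i] by (simp add: distrib_left mult.commute)
        then have "(k w * (x + \<mu> i) + snd (snd i)) mod p = (k w * x) mod p"
          by (simp only: mod_eq_dvd_iff dvd_triv_left)
        then show ?thesis
          using chord_sym[of E, OF sym Cw(4)[OF i, of "k w * (x + \<mu> i)"]] unfolding q_def by simp
      qed
    qed
    show "1 \<le> \<mu> i" if "i \<in> Cw" for i using \<mu>[OF that] by simp
    show "\<bar>k w\<bar> \<le> B" using k by simp
    show "\<exists>D. \<bar>D\<bar> \<le> B \<and> p dvd k w * \<mu> i - D" if "i \<in> Cw" for i
      using \<mu>[OF that] sd[OF that] by (intro exI[of _ "s i * snd (snd i)"]) simp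
  qed simp
  \<comment> \<open>Any \<open>M\<close> with \<open>k w * M \<le> p - 2 * B\<close> separates the
    lengths; dividing by \<open>3 * K\<close> rather than by \<open>K\<close> also gives
    \<open>2 * M < p\<close>.\<close>
  define M where "M = (p - 2 * B) div (3 * K)"
  have M3: "M * (3 * K) \<le> p - 2 * B"
  proof -
    have "M * (3 * K) = p - 2 * B - (p - 2 * B) mod (3 * K)"
      unfolding M_def by (rule minus_mod_eq_div_mult[symmetric])
    moreover have "0 \<le> (p - 2 * B) mod (3 * K)" using K1 by simp
    ultimately show ?thesis by linarith
  qed
  have "n * (4 * B + 2) + 11 \<le> M"
  proof -
    have "X = (3 * K * X) div (3 * K)" using K1 by simp
    also have "\<dots> \<le> M" unfolding M_def using BX K1 by (intro zdiv_mono1) auto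
    finally show ?thesis unfolding X_def .
  qed
  moreover have "int (card Cw) * (2 * (2 * B) + 2) \<le> n * (4 * B + 2)"
    using mult_right_mono[OF cardC, of "4 * B + 2"] B1 by simp
  ultimately have M: "int (card Cw) * (2 * (2 * B) + 2) + 10 \<le> M" "1 \<le> M"
    using nB by linarith+
  have Mk: "k w * M \<le> p - 2 * B"
  proof -
    have "k w * M \<le> (3 * K) * M" using k M K1 by (intro mult_right_mono) auto
    then show ?thesis using M3 by (simp add: algebra_simps)
  qed
  have M2: "2 * M < p"
  proof -
    have "2 * M \<le> (3 * K) * M" using K1 M by (intro mult_right_mono) auto
    then show ?thesis using M3 B1 by (simp add: algebra_simps)
  qed
  obtain cs where cs: "set cs = Cw" "distinct cs" using finite_distinct_list[OF finC] by blast
  define ss where "ss = filter (\<lambda>i. r i = 0) cs"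
  define ls where "ls = filter (\<lambda>i. r i \<noteq> 0) cs"
  have sl: "distinct (ss @ ls)" "set (ss @ ls) = Cw" "length (ss @ ls) = card Cw"
    using cs distinct_card[OF cs(2)] sum_length_filter_compl[of "\<lambda>i. r i = 0" cs]
    unfolding ss_def ls_def by auto
  have small_mu: "\<mu> i \<le> 2 * B" if "i \<in> set ss" for i
  proof -
    have i: "i \<in> Cw" "r i = 0" using that cs unfolding ss_def by auto
    have "1 * \<mu> i \<le> k w * \<mu> i" using \<mu>[OF i(1)] k by (intro mult_right_mono) auto
    then show ?thesis using \<mu>[OF i(1)] sd[OF i(1)] i(2) B1 by auto
  qed
  have large_mu: "M \<le> \<mu> i" if "i \<in> set ls" for i
  proof -
    have i: "i \<in> Cw" "r i \<noteq> 0" using that cs unfolding ls_def by auto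
    have "1 * p \<le> r i * p" using \<mu>[OF i(1)] i(2) p_pos by (intro mult_right_mono) auto
    then have "k w * M \<le> k w * \<mu> i" using \<mu>[OF i(1)] sd[OF i(1)] Mk B1 by linarith
    then show ?thesis using k by simp
  qed
  have gap: "\<mu> i \<le> \<mu> j + 2 * B \<or> \<mu> j + M \<le> \<mu> i" if "i \<in> Cw" "j \<in> Cw" for i j
  proof (cases "r j < r i")
    case True
    then have "1 * p \<le> (r i - r j) * p" using p_pos by (intro mult_right_mono) auto
    then have "k w * M \<le> k w * \<mu> i - k w * \<mu> j"
      using \<mu>[OF that(1)] \<mu>[OF that(2)] sd[OF that(1)] sd[OF that(2)] Mk
      by (simp add: left_diff_distrib)
    then have "k w * M \<le> k w * (\<mu> i - \<mu> j)" by (simp add: algebra_simps)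
    then show ?thesis using k by (simp add: mult_le_cancel_left_pos)
  next
    case False
    then have "r i * p \<le> r j * p" using p_pos by (intro mult_right_mono) auto
    then have "k w * \<mu> i - k w * \<mu> j \<le> 2 * B"
      using \<mu>[OF that(1)] \<mu>[OF that(2)] sd[OF that(1)] sd[OF that(2)] by linarith
    then have *: "k w * (\<mu> i - \<mu> j) \<le> 2 * B" by (simp only: right_diff_distrib)
    show ?thesis
    proof (rule ccontr)
      assume "\<not> ?thesis"
      then have "2 * B < \<mu> i - \<mu> j" by simp
      moreover from this have "1 * (\<mu> i - \<mu> j) \<le> k w * (\<mu> i - \<mu> j)"
        using k B1 by (intro mult_right_mono) auto
      ultimately show False using * by simp
    qed
  qed
  have "\<exists>\<alpha> y. route {0..<p} Cw \<alpha> y \<and> small (4 * length (ss @ ls) + 2) (y - \<alpha>)"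
  proof (rule absorb[OF sl(1,2)])
    show "\<forall>i\<in>set ss. \<mu> i \<le> 2 * B" using small_mu by blast
    show "\<forall>i\<in>set ls. M \<le> \<mu> i \<and> 2 * \<mu> i < p" using large_mu \<mu> sl(2) by auto
    have "set ls \<subseteq> Cw" using sl(2) by auto
    then show "\<forall>i\<in>set ls. \<forall>j\<in>set ls. \<mu> i \<le> \<mu> j + 2 * B \<or> \<mu> j + M \<le> \<mu> i"
      using gap by (meson subsetD)
  qed (use M M2 B1 sl(3) in auto)
  then obtain \<alpha> y D where y: "route {0..<p} Cw \<alpha> y" "\<bar>D\<bar> \<le> int (4 * card Cw + 2) * B"
      "p dvd k w * (y - \<alpha>) - D"
    unfolding small_def sl(3) by blast
  have D_le: "\<bar>D\<bar> \<le> (4 * n + 2) * B"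
  proof -
    have "int (4 * card Cw + 2) * B \<le> (4 * n + 2) * B"
      using cardC B1 by (intro mult_right_mono) auto
    then show ?thesis using y(2) by linarith
  qed
  let ?A = "insert w (\<Union>(r, A, d)\<in>Cw. A)"
  have "q ` {0..<p} = {w} \<times> {0..<p}"
  proof (rule card_subset_eq)
    show "q ` {0..<p} \<subseteq> {w} \<times> {0..<p}" unfolding q_def using p_pos by auto
    show "card (q ` {0..<p}) = card ({w} \<times> {0..<p})"
      using card_image[OF inj] by simp
  qed simp
  then have cover: "q ` {0..<p} \<union> \<Union>(S ` Cw) = fibres ?A"
    unfolding S_def fibres_def by (auto split: prod.splits)
  have path: "ham_path E (fibres ?A) (q \<alpha>) (q y)"
    and ends: "\<alpha> \<in> {0..<p}" "y \<in> {0..<p}"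
    using y(1) unfolding route_def cover by auto
  have "D \<noteq> 0"
  proof
    assume "D = 0"
    then have "q y = q \<alpha>"
      using y(3) unfolding q_def by (simp add: mod_eq_dvd_iff right_diff_distrib)
    with path have "fibres ?A = {q \<alpha>}" using ham_path_same_ends[of E] by simp
    moreover have "(w, 0) \<in> fibres ?A" "(w, 1) \<in> fibres ?A" using p_pos unfolding fibres_def by auto
    ultimately show False by (metis prod.inject singletonD zero_neq_one)
  qed
  \<comment> \<open>Translation by \<open>c - k w * \<alpha>\<close> moves the start of the one path
    found to \<open>c\<close>.\<close>
  have all: "ham_path E (fibres ?A) (w, c mod p) (w, (c + D) mod p)" for c
  proof -
    have 1: "((k w * \<alpha>) mod p + (c - k w * \<alpha>)) mod p = c mod p" by (simp add: mod_simps)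
    have "(k w * y + (c - k w * \<alpha>)) mod p = (c + D) mod p"
      using y(3) by (simp add: mod_eq_dvd_iff algebra_simps)
    then have 2: "((k w * y) mod p + (c - k w * \<alpha>)) mod p = (c + D) mod p" by (simp add: mod_simps)
    show ?thesis
      using ham_path_shift[OF path[unfolded q_def], of "c - k w * \<alpha>"] unfolding 1 2 .
  qed
  \<comment> \<open>The displacement \<open>D\<close> may be negative; reversing the path then gives
    the positive length.\<close>
  show ?thesis
    unfolding Cw_def[symmetric] n_def[symmetric]
  proof (intro exI[of _ "\<bar>D\<bar>"] conjI allI)
    show "ham_path E (fibres ?A) (w, c mod p) (w, (c + \<bar>D\<bar>) mod p)" for c
    proof (cases "0 \<le> D")
      case True
      then show ?thesis using all by simp
    next
      case False
      then show ?thesis using ham_path_rev[of E, OF sym all[of "c - D"]] by simp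
    qed
  qed (use \<open>D \<noteq> 0\<close> D_le in auto)
qed

text \<open>The path through the fibres at \<open>w\<close> is entered and left by edges of the same
  class, traversed in opposite directions, so their voltage \<open>h\<close> cancels and the chord
  at \<open>r\<close> has the length \<open>D\<close> of the path. The chords at \<open>w\<close>
  are swallowed by it and all others are kept.\<close>

lemma grow_system:
  assumes C: "chord_system (insert w R) C B" and w: "w \<in> V" "w \<notin> R" and r: "r \<in> R" "nb r w"
    and B: "K \<le> B" "2 * B + 3 * K * (int (card V) * (4 * B + 2) + 11) \<le> p" "0 \<le> B"
  shows "\<exists>C'. chord_system R C' ((4 * int (card V) + 2) * B)"
proof -
  let ?Cw = "{i \<in> C. fst i = w}"
  define A' where "A' = insert w (\<Union>(r, A, d)\<in>?Cw. A)"
  define B' where "B' = (4 * int (card V) + 2) * B"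
  have BB: "B \<le> B'"
    using mult_right_mono[of 1 "4 * int (card V) + 2" B] B(3) unfolding B'_def by simp
  obtain D where D: "0 < D" "D \<le> B'" "\<And>c. ham_path E (fibres A') (w, c mod p) (w, (c + D) mod p)"
    using absorb_fibre[OF C w B(1,2)] unfolding A'_def B'_def by blast
  obtain h where h: "\<And>a. E (r, a mod p) (w, (a + h) mod p)"
    using r(2) unfolding nb_def by blast
  have new: "chord E (fibres A') (r, c mod p) (r, (c + D) mod p)" for c
    unfolding chord_def
  proof (intro exI conjI)
    show "ham_path E (fibres A') (w, (c + h) mod p) (w, (c + h + D) mod p)" by (rule D(3))
    show "E (r, c mod p) (w, (c + h) mod p)" by (rule h)
    show "E (w, (c + h + D) mod p) (r, (c + D) mod p)"
      using sym[OF h[of "c + D"]] by (simp add: algebra_simps)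
  qed
  have fin: "finite C" and sys: "\<forall>(r, A, d)\<in>C. r \<in> insert w R \<and> 0 < d \<and> d \<le> B \<and>
       (\<forall>c. chord E (fibres A) (r, c mod p) (r, (c + d) mod p))"
    and dis: "\<forall>i\<in>C. \<forall>j\<in>C. i \<noteq> j \<longrightarrow> fst (snd i) \<inter> fst (snd j) = {}"
    and un: "(\<Union>i\<in>C. fst (snd i)) = V - insert w R"
    using C unfolding chord_system_def by (auto simp: case_prod_beta)
  have A': "A' = insert w (\<Union>i\<in>?Cw. fst (snd i))"
    unfolding A'_def by (simp add: case_prod_beta)
  let ?C' = "insert (r, A', D) (C - ?Cw)"
  have old_new: "fst (snd i) \<inter> A' = {}" if "i \<in> C - ?Cw" for i
  proof -
    have "fst (snd i) \<inter> fst (snd j) = {}" if j: "j \<in> ?Cw" for j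
    proof -
      have "i \<in> C" "j \<in> C" "i \<noteq> j" using j \<open>i \<in> C - ?Cw\<close> by auto
      then show ?thesis using dis by blast
    qed
    moreover have "w \<notin> fst (snd i)" using un \<open>i \<in> C - ?Cw\<close> by blast
    ultimately show ?thesis unfolding A' by blast
  qed
  have "chord_system R ?C' B'"
    unfolding chord_system_def
  proof (intro conjI)
    show "finite ?C'" using fin by simp
    have "\<forall>(r, A, d)\<in>C - ?Cw. r \<in> R \<and> 0 < d \<and> d \<le> B' \<and>
       (\<forall>c. chord E (fibres A) (r, c mod p) (r, (c + d) mod p))"
    proof (intro ballI)
      fix i assume i: "i \<in> C - ?Cw"
      have "case i of (r, A, d) \<Rightarrow> r \<in> insert w R \<and> 0 < d \<and> d \<le> B \<and>
       (\<forall>c. chord E (fibres A) (r, c mod p) (r, (c + d) mod p))"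
        by (rule bspec[OF sys]) (use i in simp)
      then show "case i of (r, A, d) \<Rightarrow> r \<in> R \<and> 0 < d \<and> d \<le> B' \<and>
       (\<forall>c. chord E (fibres A) (r, c mod p) (r, (c + d) mod p))"
        using i BB by (cases i) simp
    qed
    then show "\<forall>(r, A, d)\<in>?C'. r \<in> R \<and> 0 < d \<and> d \<le> B' \<and>
       (\<forall>c. chord E (fibres A) (r, c mod p) (r, (c + d) mod p))"
      using r(1) D(1,2) new by simp
    show "\<forall>i\<in>?C'. \<forall>j\<in>?C'. i \<noteq> j \<longrightarrow> fst (snd i) \<inter> fst (snd j) = {}"
    proof (intro ballI impI)
      fix i j assume ij: "i \<in> ?C'" "j \<in> ?C'" "i \<noteq> j"
      then consider "i \<in> C - ?Cw" "j \<in> C - ?Cw" | "i \<in> C - ?Cw" "j = (r, A', D)"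
        | "i = (r, A', D)" "j \<in> C - ?Cw" by blast
      then show "fst (snd i) \<inter> fst (snd j) = {}"
      proof cases
        case 1
        then show ?thesis using dis ij(3) by blast
      next
        case 2
        then show ?thesis using old_new[of i] by simp
      next
        case 3
        then show ?thesis using old_new[of j] by (simp add: Int_commute)
      qed
    qed
    have "(\<Union>i\<in>?C'. fst (snd i)) = insert w (\<Union>i\<in>C. fst (snd i))"
      unfolding A' by auto
    also have "\<dots> = V - R" using un w by auto
    finally show "(\<Union>(r, A, d)\<in>?C'. A) = V - R" by (simp add: case_prod_beta)
  qed
  then show ?thesis unfolding B'_def by blast
qed

section \<open>The last two fibres\<close>

lemma closed_ladder:
  assumes C: "chord_system {u, v} C B" and uv: "u \<in> V" "v \<in> V" "u \<noteq> v" "k u = 1" "k v = 1" "nb u v"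
    and B: "int (card V) * (B + 2) < p" "0 \<le> B"
  shows "\<exists>a b. ham_path E (fibres V) a b \<and> E b a"
proof -
  obtain h where h: "\<And>a. E (u, a mod p) (v, (a + h) mod p)"
    using uv(6) unfolding nb_def by blast
  \<comment> \<open>Shifting the coordinates over \<open>v\<close> by \<open>h\<close> turns the
    edges between the two fibres into rungs; the rails have step \<open>1\<close> because
    \<open>k u = 1\<close> and \<open>k v = 1\<close>.\<close>
  define q where "q = (\<lambda>(b, x). if b then (u, x mod p) else (v, (x + h) mod p))"
  define S where "S i = fibres (fst (snd i))" for i :: "'v \<times> 'v set \<times> int"
  define d where "d i = snd (snd i)" for i :: "'v \<times> 'v set \<times> int"
  define host where "host i \<longleftrightarrow> fst i = u" for i :: "'v \<times> 'v set \<times> int"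
  have qeq: "q (b, x) = q (b', y) \<longleftrightarrow> b = b' \<and> x mod p = y mod p" for b b' x y
  proof -
    have "(x + h) mod p = (y + h) mod p \<longleftrightarrow> x mod p = y mod p" by (simp add: mod_eq_dvd_iff)
    then show ?thesis using uv(3) by (auto simp: q_def)
  qed
  have fin: "finite C" and sys: "\<forall>(r, A, d)\<in>C. r \<in> {u, v} \<and> 0 < d \<and> d \<le> B \<and>
       (\<forall>c. chord E (fibres A) (r, c mod p) (r, (c + d) mod p))"
    and dis: "\<forall>i\<in>C. \<forall>j\<in>C. i \<noteq> j \<longrightarrow> fst (snd i) \<inter> fst (snd j) = {}"
    and un: "(\<Union>i\<in>C. fst (snd i)) = V - {u, v}"
    using C unfolding chord_system_def by (auto simp: case_prod_beta)
  have C': "fst i \<in> {u, v} \<and> 0 < d i \<and> d i \<le> B" "chord E (S i) (fst i, c mod p) (fst i, (c + d i) mod p)"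
    if mem: "i \<in> C" for i c
  proof -
    have "case i of (r, A, d) \<Rightarrow> r \<in> {u, v} \<and> 0 < d \<and> d \<le> B \<and>
       (\<forall>c. chord E (fibres A) (r, c mod p) (r, (c + d) mod p))"
      by (rule bspec[OF sys mem])
    then show "fst i \<in> {u, v} \<and> 0 < d i \<and> d i \<le> B"
      "chord E (S i) (fst i, c mod p) (fst i, (c + d i) mod p)"
      unfolding d_def S_def by (cases i; simp)+
  qed
  \<comment> \<open>Kept general in \<open>J\<close>, because the ragged case represents the
    vertices of the prism by other coordinates.\<close>
  have lad: "ladder E q J S C host d" if inj: "inj_on q J" for J
  proof
    show "E x y \<Longrightarrow> E y x" for x y by (rule sym)
    show "inj_on q J" by fact
    show "S i \<inter> q ` J = {}" if "i \<in> C" for i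
    proof -
      have "fst (snd i) \<subseteq> V - {u, v}" using un that by blast
      then show ?thesis unfolding S_def fibres_def q_def by (auto split: if_splits)
    qed
    show "S i \<inter> S j = {}" if "i \<in> C" "j \<in> C" "i \<noteq> j" for i j
    proof -
      have "fst (snd i) \<inter> fst (snd j) = {}" using dis that by blast
      then show ?thesis unfolding S_def fibres_def by auto
    qed
    show "E (q (b, x)) (q (b, x + 1))" for b x
      using loop[OF uv(1), of x] loop[OF uv(2), of "x + h"] uv(4,5)
      unfolding q_def by (simp add: algebra_simps)
    show "E (q (b, x)) (q (\<not> b, x))" for b x
      using h[of x] sym[OF h[of x]] unfolding q_def by simp
    show "0 < d i" if "i \<in> C" for i using C'(1)[OF that] by blast
    show "chord E (S i) (q (host i, x)) (q (host i, x + d i))" if "i \<in> C" for i x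
    proof (cases "fst i = u")
      case True
      then show ?thesis using C'(2)[OF that, of x] unfolding q_def host_def by simp
    next
      case False
      then have "fst i = v" using C'(1)[OF that] by blast
      then show ?thesis using C'(2)[OF that, of "x + h"] False
        unfolding q_def host_def by (simp add: algebra_simps)
    qed
  qed
  have rng: "q ` J = {u, v} \<times> {0..<p}" if ex: "\<And>b x. \<exists>y. (b, y) \<in> J \<and> x mod p = y mod p" for J
  proof
    show "q ` J \<subseteq> {u, v} \<times> {0..<p}" unfolding q_def using p_pos by (auto split: if_splits)
    show "{u, v} \<times> {0..<p} \<subseteq> q ` J"
    proof clarify
      fix w x assume w: "w \<in> {u, v}" and x: "x \<in> {0..<p}"
      define b where "b \<longleftrightarrow> w = u"
      obtain y where y: "(b, y) \<in> J" "(if b then x else x - h) mod p = y mod p" using ex by blast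
      then have "q (b, if b then x else x - h) = q (b, y)" by (simp add: qeq)
      moreover have "q (b, if b then x else x - h) = (w, x)"
        using w x unfolding q_def b_def by auto
      ultimately show "(w, x) \<in> q ` J" using y(1) by (metis imageI)
    qed
  qed
  have cover: "\<exists>a b. ham_path E (fibres V) a b \<and> E b a"
    if inj: "inj_on q J" and all: "\<And>b x. \<exists>y. (b, y) \<in> J \<and> x mod p = y mod p"
      and c: "\<exists>a b. chorded.route E q J S C J C a b \<and> E (q b) (q a)" for J
  proof -
    interpret ladder E q J S C host d by (rule lad[OF inj])
    have "q ` J \<union> \<Union>(S ` C) = fibres V"
      using rng[of J] all un uv unfolding S_def fibres_def by auto
    then show ?thesis using c unfolding route_def by metis
  qed
  obtain cs where cs: "set cs = C" "distinct cs" using finite_distinct_list[OF fin] by blast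
  define os us vs where "os = filter (\<lambda>i. odd (d i)) cs"
    and "us = filter (\<lambda>i. even (d i) \<and> host i) cs"
    and "vs = filter (\<lambda>i. even (d i) \<and> \<not> host i) cs"
  have len: "(\<Sum>i\<leftarrow>xs. d i + 2) < p" if "distinct xs" "set xs \<subseteq> C" for xs
  proof -
    have "\<forall>i\<in>set xs. d i + 2 \<le> B + 2" using C'(1) that(2) by fastforce
    then have "(\<Sum>i\<leftarrow>xs. d i + 2) \<le> int (length xs) * (B + 2)"
      by (induction xs) (auto simp: algebra_simps)
    also have "int (length xs) \<le> int (card V)"
      using chord_system_card[OF C] card_mono[OF fin that(2)] distinct_card[OF that(1)] by simp
    then have "int (length xs) * (B + 2) \<le> int (card V) * (B + 2)"
      using B(2) by (intro mult_right_mono) auto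
    finally show ?thesis using B(1) by linarith
  qed
  have len': "(\<Sum>i\<leftarrow>xs. d i + 1) < p" if "distinct xs" "set xs \<subseteq> C" for xs
  proof -
    have "(\<Sum>i\<leftarrow>xs. d i + 1) \<le> (\<Sum>i\<leftarrow>xs. d i + 2)" by (rule sum_list_mono) simp
    then show ?thesis using len[OF that] by simp
  qed
  have parts: "distinct (os @ us @ vs)" "set (os @ us @ vs) = C" "\<forall>i\<in>set os. odd (d i)"
      "\<forall>i\<in>set us. even (d i) \<and> host i = True" "\<forall>i\<in>set vs. even (d i) \<and> host i = False"
    using cs unfolding os_def us_def vs_def by auto
  have count: "length (filter (\<lambda>i. even (d i)) cs) = length us + length vs"
    unfolding us_def vs_def by (induction cs) auto
  let ?J = "UNIV \<times> {0..p - 1} :: (bool \<times> int) set"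
  have inj: "inj_on q ?J"
    by (rule inj_onI) (auto simp: qeq)
  have all: "\<exists>y. (b, y) \<in> ?J \<and> x mod p = y mod p" for b x
    using p_pos by (intro exI[of _ "x mod p"]) auto
  consider (strand) "odd (length us + length vs)" | (front) "even (length us)" "even (length vs)"
    | (ragged) "odd (length us)" "odd (length vs)" by auto
  then show ?thesis
  proof cases
    case strand
    interpret ladder E q ?J S C host d by (rule lad[OF inj])
    show ?thesis
    proof (rule cover[OF inj all closed_strand[of p cs]])
      show "q (b, p) = q (b, 0)" for b by (simp add: qeq)
    qed (use cs strand count odd_p len in auto)
  next
    case front
    interpret ladder E q ?J S C host d by (rule lad[OF inj])
    show ?thesis
      by (rule cover[OF inj all closed_front[OF refl parts front]]; rule len') (use parts(1,2) in simp_all)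
  next
    case ragged
    \<comment> \<open>Each vertex of the prism is again represented once, with
      \<open>(False, p)\<close> in place of \<open>(False, 0)\<close>.\<close>
    let ?J' = "{(True, 0), (False, p)} \<union> UNIV \<times> {1..p - 1}"
    have inj': "inj_on q ?J'"
    proof (rule inj_onI)
      fix s t assume st: "s \<in> ?J'" "t \<in> ?J'" "q s = q t"
      obtain b x b' y where *: "s = (b, x)" "t = (b', y)" by (cases s; cases t)
      have "b = b'" "x mod p = y mod p" using st(3) unfolding * qeq by auto
      then show "s = t" using st(1,2) p_pos unfolding * by auto
    qed
    have all': "\<exists>y. (b, y) \<in> ?J' \<and> x mod p = y mod p" for b x
    proof (cases "x mod p = 0")
      case True
      then show ?thesis by (cases b) auto
    next
      case False
      moreover have "0 \<le> x mod p" "x mod p < p" using p_pos by simp_all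
      ultimately have "0 < x mod p" "x mod p < p" by linarith+
      then show ?thesis by (intro exI[of _ "x mod p"]) auto
    qed
    obtain a us' b vs' where ab: "us = a # us'" "vs = b # vs'" using ragged by (cases us; cases vs) auto
    interpret ladder E q ?J' S C host d by (rule lad[OF inj'])
    show ?thesis
    proof (rule cover[OF inj' all' closed_ragged_front[OF refl, of a b os us' vs']])
      show "distinct (a # b # os @ us' @ vs')" "set (a # b # os @ us' @ vs') = C"
        using parts(1,2) unfolding ab by auto
      then show "(\<Sum>i\<leftarrow>a # b # os @ us' @ vs'. d i + 1) < p" using len' by blast
      show "even (length us')" "even (length vs')" using ragged unfolding ab by auto
    qed (use parts(3-5) in \<open>simp_all add: ab\<close>)
  qed
qed

text \<open>Contraction proceeds from \<open>R = V\<close>, where there are no chords, down to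
  \<open>{u, v}\<close>, whereas connectivity enlarges a given set \<open>R\<close>. The induction
  therefore goes up in the size \<open>m\<close> of \<open>R\<close> and proves an implication: any
  chord system on \<open>R\<close> with bound \<open>g ^ (card V - m) * K\<close> yields the cycle.
  Each of the \<open>card V - m\<close> contractions has cost a factor \<open>g\<close>, and for
  \<open>R = V\<close> the empty system applies.\<close>

theorem hamiltonian_cycle:
  assumes uv: "u \<in> V" "v \<in> V" "u \<noteq> v" "k u = 1" "k v = 1" "nb u v"
    and connected: "\<And>R. R \<subseteq> V \<Longrightarrow> u \<in> R \<Longrightarrow> R \<noteq> V \<Longrightarrow> \<exists>r\<in>R. \<exists>w\<in>V - R. nb r w"
    and B: "B = (4 * int (card V) + 2) ^ card V * K"
    and p: "2 * B + 3 * K * (int (card V) * (4 * B + 2) + 11) + int (card V) * (B + 2) < p"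
  shows "\<exists>a b. ham_path E (fibres V) a b \<and> E b a"
proof -
  define g where "g = 4 * int (card V) + 2"
  have g: "1 \<le> g" unfolding g_def by simp
  have K: "1 \<le> K" using k_le[OF uv(1)] uv(4) by simp
  have gB: "g ^ j * K \<le> B" "K \<le> g ^ j * K" if "j \<le> card V" for j
    using that g K power_increasing[OF that g] one_le_power[OF g, of j] unfolding B g_def
    by (auto intro: mult_right_mono)
  \<comment> \<open>Both requirements on \<open>p\<close> are monotone in the bound on the chord
    lengths, so the largest value \<open>B\<close> covers all stages.\<close>
  have bound: "2 * b + 3 * K * (int (card V) * (4 * b + 2) + 11) \<le> p" "int (card V) * (b + 2) < p"
    if b: "b \<le> B" "0 \<le> b" for b
  proof -
    have 1: "int (card V) * (4 * b + 2) \<le> int (card V) * (4 * B + 2)"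
      "int (card V) * (b + 2) \<le> int (card V) * (B + 2)" using b by (auto intro: mult_left_mono)
    then have "3 * K * (int (card V) * (4 * b + 2) + 11) \<le> 3 * K * (int (card V) * (4 * B + 2) + 11)"
      using K by (intro mult_left_mono) auto
    moreover have "0 \<le> 3 * K * (int (card V) * (4 * B + 2) + 11)" "0 \<le> int (card V) * (B + 2)"
      using K b by simp_all
    ultimately show "2 * b + 3 * K * (int (card V) * (4 * b + 2) + 11) \<le> p" "int (card V) * (b + 2) < p"
      using 1 p b by linarith+
  qed
  define H where "H \<longleftrightarrow> (\<exists>a b. ham_path E (fibres V) a b \<and> E b a)"
  have "\<exists>R. {u, v} \<subseteq> R \<and> R \<subseteq> V \<and> card R = m \<and>
      (\<forall>C. chord_system R C (g ^ (card V - m) * K) \<longrightarrow> H)" if "2 \<le> m" "m \<le> card V" for m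
    using that
  proof (induction m rule: nat_induct_at_least)
    case base
    have "0 \<le> g ^ (card V - 2) * K" "g ^ (card V - 2) * K \<le> B"
      using gB[of "card V - 2"] K by auto
    then have "chord_system {u, v} C (g ^ (card V - 2) * K) \<Longrightarrow> H" for C
      unfolding H_def using closed_ladder[OF _ uv bound(2)] by blast
    then show ?case using uv by (intro exI[of _ "{u, v}"]) auto
  next
    case (Suc m)
    have "m \<le> card V" using Suc.prems by simp
    from Suc.IH[OF this] obtain R where R: "{u, v} \<subseteq> R" "R \<subseteq> V" "card R = m"
      "\<And>C. chord_system R C (g ^ (card V - m) * K) \<Longrightarrow> H" by blast
    have "R \<noteq> V" using R(3) Suc by auto
    then obtain r w where rw: "r \<in> R" "w \<in> V" "w \<notin> R" "nb r w" using connected[of R] R by auto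
    have fR: "finite R" using R(2) finite_V finite_subset by blast
    have e: "card V - m = Suc (card V - Suc m)" using Suc by simp
    have "H" if sys: "chord_system (insert w R) C (g ^ (card V - Suc m) * K)" for C
    proof -
      have b: "K \<le> g ^ (card V - Suc m) * K" "g ^ (card V - Suc m) * K \<le> B" "0 \<le> g ^ (card V - Suc m) * K"
        using gB[of "card V - Suc m"] K by auto
      obtain C' where "chord_system R C' (g * (g ^ (card V - Suc m) * K))"
        using grow_system[OF sys rw(2,3,1,4) b(1) bound(1)[OF b(2,3)] b(3)] unfolding g_def by blast
      then show ?thesis using R(4)[of C'] unfolding e by (simp add: mult.assoc)
    qed
    then show ?case
      using R rw fR by (intro exI[of _ "insert w R"]) auto
  qed
  moreover have "2 \<le> card V"
    using card_mono[OF finite_V, of "{u, v}"] uv by simp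
  ultimately obtain R where R: "R \<subseteq> V" "card R = card V"
    "\<And>C. chord_system R C (g ^ (card V - card V) * K) \<Longrightarrow> H" by blast
  have "R = V" using R(1,2) finite_V card_subset_eq by blast
  then have "chord_system R {} (g ^ (card V - card V) * K)" unfolding chord_system_def by simp
  then have H using R(3) by blast
  then show ?thesis unfolding H_def .
qed

end

section \<open>Reflexive trees\<close>

text \<open>Arcs of a pair digraph are pairs of vertices, so a vertex list zipped with its tail
  followed by \<open>z\<close> is the arc list of a walk; the choice \<open>z = hd l\<close> makes
  it closed.\<close>

lemma cas_zip:
  fixes G :: "'a pair_pre_digraph"
  assumes "l \<noteq> []"
  shows "pre_digraph.cas (with_proj G) (hd l) (zip l (tl l @ [z])) z \<and>
    pre_digraph.awalk_verts (with_proj G) (hd l) (zip l (tl l @ [z])) = l @ [z]"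
  using assms
proof (induction l)
  case Nil
  then show ?case by simp
next
  case (Cons x xs)
  then show ?case
    by (cases xs) (auto simp: pre_digraph.cas.simps pre_digraph.awalk_verts.simps)
qed

lemma set_zip_successively:
  "l \<noteq> [] \<Longrightarrow> successively E l \<Longrightarrow> E (last l) z \<Longrightarrow> (x, y) \<in> set (zip l (tl l @ [z])) \<Longrightarrow> E x y"
proof (induction l)
  case Nil
  then show ?case by simp
next
  case (Cons a xs)
  then show ?case by (cases xs) auto
qed

lemma hamiltonianI:
  fixes G :: "'a pair_pre_digraph"
  assumes "ham_path (\<lambda>x y. (x, y) \<in> parcs G) (pverts G) a b" "(b, a) \<in> parcs G" "3 \<le> card (pverts G)"
  shows "hamiltonian G"
proof -
  let ?E = "\<lambda>x y. (x, y) \<in> parcs G"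
  obtain l where l: "l \<noteq> []" "distinct l" "set l = pverts G" "successively ?E l" "hd l = a" "last l = b"
    using assms(1) unfolding ham_path_def by blast
  let ?c = "zip l (tl l @ [a])"
  have len: "length (tl l @ [a]) = length l" using l(1) by (cases l) auto
  have arcs: "set ?c \<subseteq> parcs G"
    using set_zip_successively[of l ?E a] l assms(2) by auto
  have walk: "pre_digraph.cas (with_proj G) a ?c a" "pre_digraph.awalk_verts (with_proj G) a ?c = l @ [a]"
    using cas_zip[OF l(1), of G a] l(5) by auto
  have "a \<in> pverts G" using l by (metis hd_in_set)
  then have "pre_digraph.awalk (with_proj G) a ?c a"
    unfolding pre_digraph.awalk_def using arcs walk(1) by simp
  moreover have "distinct (tl (pre_digraph.awalk_verts (with_proj G) a ?c))"
    unfolding walk(2) using l(1,2,5) by (cases l) auto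
  moreover have "?c \<noteq> []" using l(1) len by auto
  ultimately have "pre_digraph.cycle (with_proj G) ?c"
    unfolding pre_digraph.cycle_def by blast
  moreover have "3 \<le> length ?c"
    using len assms(3) distinct_card[OF l(2)] l(3) by simp
  moreover have "fst ` set ?c = pverts G"
    using len l(3) map_fst_zip[of l "tl l @ [a]"] by (metis list.set_map)
  ultimately show ?thesis unfolding hamiltonian_def by blast
qed

section \<open>The lift of a reflexive tree\<close>

lemma loop_at:
  assumes "reflexive_tree T" "w \<in> verts T"
  shows "is_loop T (loop_at T w)" "tail T (loop_at T w) = w" "head T (loop_at T w) = w"
    "loop_at T w \<in> arcs T"
proof -
  have "\<exists>!e. is_loop T e \<and> tail T e = w" using assms unfolding reflexive_tree_def by blast
  from theI'[OF this] show "is_loop T (loop_at T w)" "tail T (loop_at T w) = w"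
    unfolding loop_at_def by auto
  then show "head T (loop_at T w) = w" "loop_at T w \<in> arcs T" unfolding is_loop_def by auto
qed

text \<open>If no arc led out of \<open>R\<close>, everything reachable from \<open>u\<close> would
  lie in \<open>R\<close>, contrary to the connectedness of the tree. This supplies the order in
  which the fibres are contracted.\<close>

lemma crossing_arc:
  assumes T: "reflexive_tree T" and R: "R \<subseteq> verts T" "u \<in> R" "R \<noteq> verts T"
  shows "\<exists>r\<in>R. \<exists>w\<in>verts T - R. adjacent T r w"
proof (rule ccontr)
  assume no: "\<not> ?thesis"
  let ?G = "mk_symmetric (remove_loops T)"
  obtain v where v: "v \<in> verts T" "v \<notin> R" using R by blast
  have "strongly_connected ?G"
    using T unfolding reflexive_tree_def undirected_tree_def connected_def by blast
  then have "reachable ?G u v"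
    using R(1,2) v(1) unfolding strongly_connected_def by (auto simp: remove_loops_def)
  then have "(u, v) \<in> rtrancl_on (verts T) (parcs ?G)"
    unfolding reachable_def by (simp add: remove_loops_def)
  from this R(2) have "v \<in> R"
  proof (induction rule: rtrancl_on.induct)
    case rtrancl_on_refl
    then show ?case by simp
  next
    case (rtrancl_on_into_rtrancl_on x y z)
    obtain e where e: "e \<in> arcs T" "tail T e = y \<and> head T e = z \<or> tail T e = z \<and> head T e = y"
      using rtrancl_on_into_rtrancl_on(2) by (auto simp: parcs_mk_symmetric remove_loops_def)
    have "adjacent T y z"
      unfolding adjacent_def
      using e(2)
    proof
      assume "tail T e = y \<and> head T e = z"
      then show "\<exists>a\<in>arcs (bidirect T). arc_tail T a = y \<and> arc_head T a = z"
        using e(1) by (intro bexI[of _ "Pos e"]) (auto simp: bidirect_def)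
    next
      assume "tail T e = z \<and> head T e = y"
      then show "\<exists>a\<in>arcs (bidirect T). arc_tail T a = y \<and> arc_head T a = z"
        using e(1) by (intro bexI[of _ "Neg e"]) (auto simp: bidirect_def)
    qed
    then show ?case using no rtrancl_on_into_rtrancl_on by blast
  qed
  with v show False by simp
qed

lemma lift_arc_iff:
  "((x, a), (y, b)) \<in> parcs (lift T p \<sigma>) \<longleftrightarrow> 0 \<le> a \<and> a < int p \<and> 0 \<le> b \<and> b < int p \<and>
     (\<exists>e \<in> arcs (bidirect T). arc_tail T e = x \<and> arc_head T e = y \<and> \<sigma> e = (b - a) mod int p)"
  unfolding lift_def by auto

lemma voltage_mod: "\<exists>h. voltage \<phi> p e = h mod int p"
  by (cases e) auto

theorem theorem4:
  fixes T :: "('v, 'e) pre_digraph" and \<phi> :: "'e \<Rightarrow> int"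
  assumes "reflexive_tree T"
    and "\<forall>e \<in> arcs T. is_loop T e \<longrightarrow> 0 < \<phi> e"
    and "\<exists>u \<in> verts T. \<exists>v \<in> verts T. u \<noteq> v \<and> adjacent T u v \<and>
           \<phi> (loop_at T u) = 1 \<and> \<phi> (loop_at T v) = 1"
  shows "\<exists>N::nat. \<forall>p::nat. prime p \<and> N \<le> p \<longrightarrow> hamiltonian (lift T p (voltage \<phi> p))"
proof -
  obtain u v where uv: "u \<in> verts T" "v \<in> verts T" "u \<noteq> v" "adjacent T u v"
    "\<phi> (loop_at T u) = 1" "\<phi> (loop_at T v) = 1" using assms(3) by blast
  have fin: "finite (verts T)"
    using assms(1) unfolding reflexive_tree_def by (simp add: fin_digraph.finite_verts)
  define k where "k w = \<phi> (loop_at T w)" for w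
  define K where "K = (\<Sum>w\<in>verts T. k w)"
  define n where "n = int (card (verts T))"
  define B where "B = (4 * n + 2) ^ card (verts T) * K"
  \<comment> \<open>Computed from \<open>T\<close> and \<open>\<phi>\<close> alone, so that one
    threshold serves all primes.\<close>
  define bound where "bound = 2 * B + 3 * K * (n * (4 * B + 2) + 11) + n * (B + 2)"
  have k_pos: "0 < k w" if "w \<in> verts T" for w
    using assms(2) loop_at[OF assms(1) that] unfolding k_def by blast
  have k_le: "k w \<le> K" if "w \<in> verts T" for w
    unfolding K_def using member_le_sum[of w "verts T" k] that fin k_pos by (force intro: less_imp_le)
  \<comment> \<open>The maximum with \<open>3\<close> makes the prime odd.\<close>
  have "hamiltonian (lift T p (voltage \<phi> p))" if p: "prime p" "max 3 (nat bound + 1) \<le> p" for p :: nat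
  proof -
    let ?L = "lift T p (voltage \<phi> p)"
    let ?E = "\<lambda>x y. (x, y) \<in> parcs ?L"
    have p3: "3 \<le> p" "bound < int p" using p(2) by auto
    have sym: "?E x y \<Longrightarrow> ?E y x" for x y
    proof -
      have "arcs_ends ?L = parcs ?L" unfolding arcs_ends_def arc_to_ends_def by simp
      then show "?E x y \<Longrightarrow> ?E y x"
        using symmetric_lift_voltage[of T p \<phi>] unfolding symmetric_def by (auto dest: symD)
    qed
    interpret cyclic_lift "verts T" ?E "int p" k K
    proof
      show "finite (verts T)" by fact
      show "prime (int p)" using p(1) by simp
      show "odd (int p)" using p(1) p3(1) prime_odd_nat[of p] by simp
      show "?E s t \<Longrightarrow> ?E t s" for s t by (rule sym)
      show "?E (x, (a + c) mod int p) (y, (b + c) mod int p)" if "?E (x, a) (y, b)" for x a y b c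
      proof -
        have "((b + c) mod int p - (a + c) mod int p) mod int p = (b - a) mod int p"
          by (simp add: mod_diff_eq)
        then show ?thesis using that p3(1) unfolding lift_arc_iff by simp
      qed
      show "?E (w, a mod int p) (w, (a + k w) mod int p)" if "w \<in> verts T" for w a
      proof -
        have "((a + k w) mod int p - a mod int p) mod int p = k w mod int p"
          by (simp add: mod_diff_eq)
        then show ?thesis
          using loop_at[OF assms(1) that] p3(1) unfolding lift_arc_iff k_def
          by (auto simp: bidirect_def intro!: bexI[of _ "Pos (loop_at T w)"])
      qed
    qed (use k_pos k_le in auto)
    have nb: "nb x y" if "adjacent T x y" for x y
    proof -
      obtain e where e: "e \<in> arcs (bidirect T)" "arc_tail T e = x" "arc_head T e = y"
        using \<open>adjacent T x y\<close> unfolding adjacent_def by blast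
      obtain h where h: "voltage \<phi> p e = h mod int p" using voltage_mod by blast
      have "?E (x, a mod int p) (y, (a + h) mod int p)" for a
      proof -
        have "((a + h) mod int p - a mod int p) mod int p = h mod int p"
          by (simp add: mod_diff_eq)
        then show ?thesis using e h p3(1) unfolding lift_arc_iff by auto
      qed
      then show ?thesis unfolding nb_def by blast
    qed
    have "\<exists>a b. ham_path ?E (fibres (verts T)) a b \<and> ?E b a"
    proof (rule hamiltonian_cycle[where u = u and v = v and B = B])
      show "\<exists>r\<in>R. \<exists>w\<in>verts T - R. nb r w"
        if "R \<subseteq> verts T" "u \<in> R" "R \<noteq> verts T" for R
        using crossing_arc[OF assms(1) that] nb by blast
      show "2 * B + 3 * K * (int (card (verts T)) * (4 * B + 2) + 11) + int (card (verts T)) * (B + 2) < int p"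
        using p3(2) unfolding bound_def n_def .
      show "B = (4 * int (card (verts T)) + 2) ^ card (verts T) * K" unfolding B_def n_def ..
    qed (use uv nb in \<open>auto simp: k_def\<close>)
    then obtain a b where ab: "ham_path ?E (fibres (verts T)) a b" "?E b a" by blast
    have verts: "pverts ?L = fibres (verts T)" unfolding lift_def fibres_def by simp
    \<comment> \<open>There is at least one fibre and it has at least three vertices, which gives
      the minimal cycle length demanded by \<open>hamiltonian\<close>.\<close>
    have "1 * 3 \<le> card (verts T) * p"
      using uv(1) fin p3(1) by (intro mult_le_mono) (auto simp: Suc_le_eq card_gt_0_iff)
    then have "3 \<le> card (pverts ?L)" unfolding verts fibres_def by (simp add: card_cartesian_product)
    with ab show ?thesis by (intro hamiltonianI) (simp_all add: verts)
  qed
  then show ?thesis by (intro exI[of _ "max 3 (nat bound + 1)"]) blast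
qed

end
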